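(* Let $\varphi$ be a Markovian random iteration associated with the pair $(p,m)$ and the measurable map $f\colon E\times M\to M$, where $(E,\mathscr{E})$, $(M,\mathscr{B})$ are standard measurable spaces and $m$ is the unique stationary probability measure of the transition probability $p$ on $E$. Let $q$ be the transition probability on $E$ in duality with $p$ relative to $m$. Then there is a one-to-one correspondence between the sets $\mathcal{S}(\varphi)$ and $I_0(\varphi)$, given by the following two mutually inverse maps: $$\hat\mu\in I_0(\varphi)\mapsto \nu\in \mathcal{S}(\varphi),\qquad \nu_\alpha=f_{\alpha*}\mu_\alpha,$$ and $$\nu\in \mathcal{S}(\varphi)\mapsto \hat\mu\in I_0(\varphi),\qquad \mu_\alpha=\int \nu_\beta\, q(\alpha,d\beta).$$ Here $\{\nu_\alpha\}_{\alpha\in E}$ is the disintegration of $\nu$ with respect to $m$, and $\{\mu_\alpha\}_{\alpha\in E}$ is the family such that $\omega\mapsto\mu_{\omega_0}$ is the disintegration of $\hat\mu$ with respect to $\mathbb{P}$.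
   Context: Setting. $(E,\mathscr{E})$ and $(M,\mathscr{B})$ are standard measurable (standard Borel) spaces. $p\colon E\times\mathscr{E}\to[0,1]$ is a transition probability ($p(\alpha,\cdot)$ is a probability measure for every $\alpha$, and $p(\cdot,A)$ is measurable for every $A$). A probability measure $m$ on $E$ is stationary for $p$ if $m(A)=\int p(\alpha,A)\,dm(\alpha)$ for all $A\in\mathscr{E}$; it is assumed that $p$ has a unique stationary measure $m$. $\Sigma=E^{\mathbb{N}}$ (indices $0,1,2,\dots$) carries the product $\sigma$-algebra, and $\mathbb{P}$ is the Markov measure on $\Sigma$ associated with $(p,m)$, i.e. the law making the coordinates $\omega_n$ a Markov chain with transition probability $p$ and initial law $m$. $\sigma$ is the shift map on $\Sigma$. $f\colon E\times M\to M$ is measurable, $f_\alpha(x)=f(\alpha,x)$. The Markovian random iteration associated with $(p,m)$ and $f$ is $\varphi(n,\omega,x)=f^n_\omega(x)=f_{\omega_{n-1}}\circ\dots\circ f_{\omega_0}(x)$. The induced skew product is $F\colon\Sigma\times M\to\Sigma\times M$, $F(\omega,x)=(\sigma(\omega),f_{\omega_0}(x))$. The symbol $*$ denotes push-forward. Disintegration. For a probability measure $\eta$ on $Y\times M$ with first marginal $\tau$ (push-forward under the projection to $Y$), its disintegration is the ($\tau$-a.e. unique) family $\{\eta_y\}_{y\in Y}$ of probability measures on $M$, with $y\mapsto\eta_y(B)$ measurable for every measurable $B$, such that $\eta(A\times B)=\int_A\eta_y(B)\,d\tau(y)$ for all measurable $A,B$. Conversely, a measurable family together with $\tau$ determines $\eta$.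 Families are identified when they agree almost everywhere. $\mathcal{S}(\varphi)$ is the set of stationary probability measures $\nu$ on $E\times M$ of the transition probability $\hat p((\alpha,x),B)=\int \mathbf{1}_B(\beta,f_\beta(x))\,p(\alpha,d\beta)$, $B\in\mathscr{E}\otimes\mathscr{B}$. Every such $\nu$ has first marginal $m$. A $\varphi$-invariant measure is a probability measure $\hat\mu$ on $\Sigma\times M$ with $F_*\hat\mu=\hat\mu$ and first marginal $\mathbb{P}$. $I_0(\varphi)$ is the set of $\varphi$-invariant measures $\hat\mu$ for which there is a family $\{\mu_\alpha\}_{\alpha\in E}$ of probability measures on $M$ such that the disintegration of $\hat\mu$ with respect to $\mathbb{P}$ is $\hat\mu_\omega=\mu_{\omega_0}$. A transition probability $q$ on $E$ is in duality with $p$ relative to $m$ if $\int_B p(\alpha,A)\,dm(\alpha)=\int_A q(\beta,B)\,dm(\beta)$ for all $A,B\in\mathscr{E}$; on standard measurable spaces it exists and is essentially unique. *)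

theory Defs
  imports "HOL-Probability.Probability"
begin

definition standard_borel :: "'a measure \<Rightarrow> bool" where
  "standard_borel N \<longleftrightarrow>
     (\<exists>T. topspace T = space N \<and> completely_metrizable_space T \<and> second_countable T \<and>
          sets N = sigma_sets (topspace T) {U. openin T U})"

text \<open>Only the measurable structure of \<open>N\<close> matters here; a transition probability on
  \<open>N\<close> is a measurable map into \<^term>\<open>prob_algebra N\<close>.\<close>

definition transition_prob :: "'a measure \<Rightarrow> ('a \<Rightarrow> 'a measure) \<Rightarrow> bool" where
  "transition_prob N k \<longleftrightarrow> k \<in> N \<rightarrow>\<^sub>M prob_algebra N"

definition stationary_measures :: "'a measure \<Rightarrow> ('a \<Rightarrow> 'a measure) \<Rightarrow> 'a measure set" where
  "stationary_measures N k =
     {\<mu> \<in> space (prob_algebra N).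
        \<forall>A\<in>sets N. emeasure \<mu> A = (\<integral>\<^sup>+x. emeasure (k x) A \<partial>\<mu>)}"

definition in_duality ::
  "'a measure \<Rightarrow> 'a measure \<Rightarrow> ('a \<Rightarrow> 'a measure) \<Rightarrow> ('a \<Rightarrow> 'a measure) \<Rightarrow> bool" where
  "in_duality N m p q \<longleftrightarrow>
     transition_prob N q \<and>
     (\<forall>A\<in>sets N. \<forall>B\<in>sets N.
        (\<integral>\<^sup>+a\<in>B. emeasure (p a) A \<partial>m) = (\<integral>\<^sup>+b\<in>A. emeasure (q b) B \<partial>m))"

abbreviation path_space :: "'a measure \<Rightarrow> (nat \<Rightarrow> 'a) measure" where
  "path_space E \<equiv> PiM UNIV (\<lambda>_. E)"

text \<open>The last condition says that \<open>a \<mapsto> p a A\<close>, evaluated at the \<open>n\<close>-th coordinate, is a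
  version of the conditional probability that the next coordinate lies in \<open>A\<close>, given
  the coordinates \<open>0, \<dots>, n\<close>.\<close>

definition markov_measure ::
  "'a measure \<Rightarrow> ('a \<Rightarrow> 'a measure) \<Rightarrow> 'a measure \<Rightarrow> (nat \<Rightarrow> 'a) measure \<Rightarrow> bool" where
  "markov_measure E p m P \<longleftrightarrow>
     P \<in> space (prob_algebra (path_space E)) \<and>
     distr P E (\<lambda>\<omega>. \<omega> 0) = m \<and>
     (\<forall>n. \<forall>A\<in>sets E. \<forall>C\<in>sets (PiM {..n} (\<lambda>_. E)).
        emeasure P {\<omega> \<in> space P. restrict \<omega> {..n} \<in> C \<and> \<omega> (Suc n) \<in> A} =
        (\<integral>\<^sup>+\<omega>\<in>{\<omega> \<in> space P. restrict \<omega> {..n} \<in> C}. emeasure (p (\<omega> n)) A \<partial>P))"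

text \<open>\<open>disintegration \<tau> N \<eta> \<kappa>\<close>: the measure \<open>\<eta>\<close> on \<open>\<tau> \<Otimes> N\<close> has first marginal \<open>\<tau>\<close>, and
  \<open>\<kappa>\<close> is (a version of) its disintegration with respect to \<open>\<tau>\<close>.\<close>

definition disintegration ::
  "'y measure \<Rightarrow> 'x measure \<Rightarrow> ('y \<times> 'x) measure \<Rightarrow> ('y \<Rightarrow> 'x measure) \<Rightarrow> bool" where
  "disintegration \<tau> N \<eta> \<kappa> \<longleftrightarrow>
     \<eta> \<in> space (prob_algebra (\<tau> \<Otimes>\<^sub>M N)) \<and>
     distr \<eta> \<tau> fst = \<tau> \<and>
     \<kappa> \<in> \<tau> \<rightarrow>\<^sub>M prob_algebra N \<and>
     (\<forall>A\<in>sets \<tau>. \<forall>B\<in>sets N. emeasure \<eta> (A \<times> B) = (\<integral>\<^sup>+y\<in>A. emeasure (\<kappa> y) B \<partial>\<tau>))"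

definition hat_transition ::
  "'e measure \<Rightarrow> 'x measure \<Rightarrow> ('e \<Rightarrow> 'e measure) \<Rightarrow> ('e \<Rightarrow> 'x \<Rightarrow> 'x) \<Rightarrow>
   'e \<times> 'x \<Rightarrow> ('e \<times> 'x) measure" where
  "hat_transition E M p f = (\<lambda>(a, x). distr (p a) (E \<Otimes>\<^sub>M M) (\<lambda>b. (b, f b x)))"

definition S_measures ::
  "'e measure \<Rightarrow> 'x measure \<Rightarrow> ('e \<Rightarrow> 'e measure) \<Rightarrow> ('e \<Rightarrow> 'x \<Rightarrow> 'x) \<Rightarrow>
   ('e \<times> 'x) measure set" where
  "S_measures E M p f = stationary_measures (E \<Otimes>\<^sub>M M) (hat_transition E M p f)"

definition skew_product ::
  "('e \<Rightarrow> 'x \<Rightarrow> 'x) \<Rightarrow> (nat \<Rightarrow> 'e) \<times> 'x \<Rightarrow> (nat \<Rightarrow> 'e) \<times> 'x" where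
  "skew_product f = (\<lambda>(\<omega>, x). (\<lambda>n. \<omega> (Suc n), f (\<omega> 0) x))"

definition invariant_measures ::
  "'e measure \<Rightarrow> 'x measure \<Rightarrow> (nat \<Rightarrow> 'e) measure \<Rightarrow> ('e \<Rightarrow> 'x \<Rightarrow> 'x) \<Rightarrow>
   ((nat \<Rightarrow> 'e) \<times> 'x) measure set" where
  "invariant_measures E M P f =
     {\<mu> \<in> space (prob_algebra (path_space E \<Otimes>\<^sub>M M)).
        distr \<mu> (path_space E \<Otimes>\<^sub>M M) (skew_product f) = \<mu> \<and>
        distr \<mu> (path_space E) fst = P}"

definition I0_measures ::
  "'e measure \<Rightarrow> 'x measure \<Rightarrow> (nat \<Rightarrow> 'e) measure \<Rightarrow> ('e \<Rightarrow> 'x \<Rightarrow> 'x) \<Rightarrow>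
   ((nat \<Rightarrow> 'e) \<times> 'x) measure set" where
  "I0_measures E M P f =
     {\<mu> \<in> invariant_measures E M P f.
        \<exists>\<mu>' :: 'e \<Rightarrow> 'x measure. disintegration P M \<mu> (\<lambda>\<omega>. \<mu>' (\<omega> 0))}"

end

theory Submission
  imports Defs
begin

text \<open>
Both families in the theorem describe the same chain, seen at two neighbouring moments. Read the
base point \<open>\<omega>\<close> as a trajectory and \<open>x\<close> as the fibre position before the map \<open>f\<^bsub>\<omega> 0\<^esub>\<close> acts. An element
\<open>\<mu>h\<close> of \<open>I\<^sub>0\<close> gives \<open>x\<close> a law \<open>\<mu>\<^bsub>\<omega> 0\<^esub>\<close> that depends on the coordinate about to act; letting that
coordinate act, the pair \<open>(\<omega> 0, f\<^bsub>\<omega> 0\<^esub> x)\<close> has the law \<open>state_law \<mu>h\<close>, whose disintegration is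
\<open>\<nu>\<^sub>\<alpha> = f\<^sub>\<alpha>\<^sub>* \<mu>\<^sub>\<alpha>\<close>. Conversely, the fibre position met by the coordinate \<open>\<alpha>\<close> was produced by the
preceding coordinate \<open>\<beta>\<close>. The conditional law of \<open>\<beta>\<close> given the present and the whole future of
the chain is \<open>q \<alpha>\<close>, so that \<open>\<mu>\<^sub>\<alpha> = \<integral> \<nu>\<^sub>\<beta> q(\<alpha>, d\<beta>)\<close>.

The probabilistic content is the lemma \<open>past_given_future\<close>: under the Markov measure \<open>P\<close>, the
law of \<open>((\<omega> 1, \<omega> 2, \<dots>), \<omega> 0)\<close> is disintegrated over \<open>P\<close> by \<open>\<omega> \<mapsto> q (\<omega> 0)\<close>. It contains the
shift invariance of \<open>P\<close> and says that the reversed chain is Markov with kernel \<open>q\<close>. It gives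
\<open>disintegration_skew_product\<close>: if \<open>\<nu>\<close> disintegrates \<open>state_law \<mu>h\<close>, then
\<open>\<omega> \<mapsto> q (\<omega> 0) \<bind> \<nu>\<close> disintegrates the image of \<open>\<mu>h\<close> under the skew product. For
an invariant \<open>\<mu>h\<close> this image is \<open>\<mu>h\<close>, so \<open>\<mu>h\<close> can be recovered from \<open>state_law \<mu>h\<close> by averaging
backwards, and \<open>state_law\<close> is injective on \<open>I\<^sub>0\<close>.

Stationarity of \<open>state_law \<mu>h\<close> is invariance of \<open>\<mu>h\<close> read after one more step. For
surjectivity, take a stationary \<open>\<eta>\<close>.
Its first marginal is stationary for \<open>p\<close>, hence equal to \<open>m\<close>, so \<open>\<eta>\<close> has a disintegration \<open>\<nu>\<close>
over \<open>m\<close>. The measure built over \<open>P\<close> from the family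
\<open>q \<alpha> \<bind> \<nu>\<close> has state law \<open>\<eta>\<close>, because one application of duality turns its state law
into one step of the transition probability on \<open>E \<times> M\<close> applied to \<open>\<eta>\<close>. It is invariant
because its image under the skew product and the measure itself then have the same disintegration.

The existence of \<open>\<nu>\<close> is where the standard Borel structure of \<open>M\<close> enters. It is
established by coding \<open>M\<close> measurably into the unit interval, with a measurable left inverse, and by
constructing conditional distribution functions on the real line from Radon--Nikodym densities.
\<close>

section \<open>Calculus of disintegrations\<close>

lemma measure_eqI_rectangles:
  assumes sets: "sets \<eta> = sets (Y \<Otimes>\<^sub>M N)" "sets \<eta>' = sets (Y \<Otimes>\<^sub>M N)"
    and fin: "finite_measure \<eta>"
    and eq: "\<And>A B. A \<in> sets Y \<Longrightarrow> B \<in> sets N \<Longrightarrow> emeasure \<eta> (A \<times> B) = emeasure \<eta>' (A \<times> B)"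
  shows "\<eta> = \<eta>'"
proof (rule measure_eqI_generator_eq[OF Int_stable_pair_measure_generator[of Y N],
      where \<Omega> = "space Y \<times> space N" and A = "\<lambda>_. space Y \<times> space N"])
  show "{a \<times> b |a b. a \<in> sets Y \<and> b \<in> sets N} \<subseteq> Pow (space Y \<times> space N)"
    by (rule pair_measure_closed)
qed (use assms finite_measure.emeasure_finite[OF fin] in \<open>auto simp: sets_pair_measure simp flip: eq\<close>)

lemma emeasure_distr_nn_integral:
  assumes "g \<in> N \<rightarrow>\<^sub>M L" "A \<in> sets L"
  shows "emeasure (distr N L g) A = (\<integral>\<^sup>+x. indicator A (g x) \<partial>N)"
  using assms by (subst nn_integral_distr[symmetric]) auto

lemma sets_Collect_mem:
  assumes "g \<in> N \<rightarrow>\<^sub>M L" "B \<in> sets L"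
  shows "{\<omega> \<in> space N. g \<omega> \<in> B} \<in> sets N"
  using measurable_sets[OF assms] by (simp add: vimage_def Int_def conj_commute)

lemma measurable_emeasure_kernel:
  assumes "\<kappa> \<in> \<tau> \<rightarrow>\<^sub>M prob_algebra N" "B \<in> sets N"
  shows "(\<lambda>y. emeasure (\<kappa> y) B) \<in> borel_measurable \<tau>"
  using measurable_compose[OF measurable_prob_algebraD[OF assms(1)] measurable_emeasure_subprob_algebra[OF assms(2)]] .

lemma kernel_space:
  assumes \<mu>: "\<mu> \<in> N \<rightarrow>\<^sub>M prob_algebra L" and \<alpha>: "\<alpha> \<in> space N"
  shows "sets (\<mu> \<alpha>) = sets L" "prob_space (\<mu> \<alpha>)"
  using measurable_space[OF \<mu> \<alpha>] by (auto simp: space_prob_algebra)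

text \<open>The marginal condition and the total mass follow from the formula on rectangles, by taking the
second factor to be the whole space.\<close>
lemma disintegrationI:
  assumes \<tau>: "prob_space \<tau>" and sets: "sets \<eta> = sets (\<tau> \<Otimes>\<^sub>M N)"
    and \<kappa>[measurable]: "\<kappa> \<in> \<tau> \<rightarrow>\<^sub>M prob_algebra N"
    and eq: "\<And>A B. A \<in> sets \<tau> \<Longrightarrow> B \<in> sets N \<Longrightarrow>
      emeasure \<eta> (A \<times> B) = (\<integral>\<^sup>+y\<in>A. emeasure (\<kappa> y) B \<partial>\<tau>)"
  shows "disintegration \<tau> N \<eta> \<kappa>"
proof -
  interpret \<tau>: prob_space \<tau> by fact
  have one: "emeasure (\<kappa> y) (space N) = 1" if "y \<in> space \<tau>" for y
    using measurable_space[OF \<kappa> that] by (rule in_space_prob_algebra)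
  have sp: "space \<eta> = space \<tau> \<times> space N"
    using sets_eq_imp_space_eq[OF sets] by (simp add: space_pair_measure)
  have cyl: "emeasure \<eta> (A \<times> space N) = emeasure \<tau> A" if A: "A \<in> sets \<tau>" for A
  proof -
    have "emeasure \<eta> (A \<times> space N) = (\<integral>\<^sup>+y. indicator A y \<partial>\<tau>)"
      unfolding eq[OF A sets.top] by (intro nn_integral_cong) (simp add: one)
    with A show ?thesis by simp
  qed
  have fst[measurable]: "fst \<in> \<eta> \<rightarrow>\<^sub>M \<tau>"
    using measurable_fst by (simp add: measurable_cong_sets[OF sets refl])
  have "prob_space \<eta>"
    by (rule prob_spaceI) (simp add: sp cyl \<tau>.emeasure_space_1)
  moreover have "distr \<eta> \<tau> fst = \<tau>"
  proof (rule measure_eqI)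
    fix A assume "A \<in> sets (distr \<eta> \<tau> fst)"
    then have A: "A \<in> sets \<tau>" by simp
    have "fst -` A \<inter> space \<eta> = A \<times> space N"
      using sets.sets_into_space[OF A] by (auto simp: sp)
    with A show "emeasure (distr \<eta> \<tau> fst) A = emeasure \<tau> A"
      by (simp add: emeasure_distr cyl)
  qed simp
  ultimately show ?thesis
    using assms by (simp add: disintegration_def space_prob_algebra)
qed

lemma disintegrationD:
  assumes "disintegration \<tau> N \<eta> \<kappa>"
  shows "prob_space \<eta>" "sets \<eta> = sets (\<tau> \<Otimes>\<^sub>M N)" "prob_space \<tau>"
    "distr \<eta> \<tau> fst = \<tau>" "\<kappa> \<in> \<tau> \<rightarrow>\<^sub>M prob_algebra N"
    "A \<in> sets \<tau> \<Longrightarrow> B \<in> sets N \<Longrightarrow> emeasure \<eta> (A \<times> B) = (\<integral>\<^sup>+y\<in>A. emeasure (\<kappa> y) B \<partial>\<tau>)"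
proof -
  show *: "prob_space \<eta>" "sets \<eta> = sets (\<tau> \<Otimes>\<^sub>M N)"  "distr \<eta> \<tau> fst = \<tau>"
     "\<kappa> \<in> \<tau> \<rightarrow>\<^sub>M prob_algebra N"
    "A \<in> sets \<tau> \<Longrightarrow> B \<in> sets N \<Longrightarrow> emeasure \<eta> (A \<times> B) = (\<integral>\<^sup>+y\<in>A. emeasure (\<kappa> y) B \<partial>\<tau>)"
    using assms by (auto simp: disintegration_def space_prob_algebra)
  have "fst \<in> \<eta> \<rightarrow>\<^sub>M \<tau>"
    using measurable_fst by (simp add: measurable_cong_sets[OF *(2) refl])
  from prob_space.prob_space_distr[OF *(1) this] show "prob_space \<tau>"
    by (simp add: *(3))
qed

lemma disintegration_determines_measure:
  assumes 1: "disintegration \<tau> N \<eta> \<kappa>" and 2: "disintegration \<tau> N \<eta>' \<kappa>"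
  shows "\<eta> = \<eta>'"
  using disintegrationD[OF 1] disintegrationD[OF 2]
  by (intro measure_eqI_rectangles[where Y = \<tau> and N = N]) (auto simp: prob_space.finite_measure)

text \<open>Every kernel over a probability measure comes from a joint law: draw the base point first, then
the fibre point.\<close>
lemma disintegration_bind:
  assumes \<tau>: "prob_space \<tau>" and \<kappa>[measurable]: "\<kappa> \<in> \<tau> \<rightarrow>\<^sub>M prob_algebra N"
  shows "disintegration \<tau> N (\<tau> \<bind> (\<lambda>y. distr (\<kappa> y) (\<tau> \<Otimes>\<^sub>M N) (Pair y))) \<kappa>"
proof (rule disintegrationI[OF \<tau> _ \<kappa>])
  have \<tau>': "\<tau> \<in> space (prob_algebra \<tau>)"
    using \<tau> by (simp add: space_prob_algebra)
  have k[measurable]: "(\<lambda>y. distr (\<kappa> y) (\<tau> \<Otimes>\<^sub>M N) (Pair y)) \<in> \<tau> \<rightarrow>\<^sub>M prob_algebra (\<tau> \<Otimes>\<^sub>M N)"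
    by measurable
  show "sets (\<tau> \<bind> (\<lambda>y. distr (\<kappa> y) (\<tau> \<Otimes>\<^sub>M N) (Pair y))) = sets (\<tau> \<Otimes>\<^sub>M N)"
    by (rule sets_bind'[OF \<tau>' k])
  fix A B assume [measurable]: "A \<in> sets \<tau>" "B \<in> sets N"
  have "emeasure (\<tau> \<bind> (\<lambda>y. distr (\<kappa> y) (\<tau> \<Otimes>\<^sub>M N) (Pair y))) (A \<times> B) =
      (\<integral>\<^sup>+y. emeasure (distr (\<kappa> y) (\<tau> \<Otimes>\<^sub>M N) (Pair y)) (A \<times> B) \<partial>\<tau>)"
    by (rule emeasure_bind_prob_algebra[OF \<tau>' k]) simp
  also have "\<dots> = (\<integral>\<^sup>+y\<in>A. emeasure (\<kappa> y) B \<partial>\<tau>)"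
  proof (rule nn_integral_cong)
    fix y assume y: "y \<in> space \<tau>"
    have s: "sets (\<kappa> y) = sets N"
      using measurable_space[OF \<kappa> y] by (simp add: space_prob_algebra)
    have "Pair y \<in> \<kappa> y \<rightarrow>\<^sub>M \<tau> \<Otimes>\<^sub>M N"
      using y by (simp add: measurable_cong_sets[OF s refl])
    then have "emeasure (distr (\<kappa> y) (\<tau> \<Otimes>\<^sub>M N) (Pair y)) (A \<times> B) =
        emeasure (\<kappa> y) (Pair y -` (A \<times> B) \<inter> space (\<kappa> y))"
      by (simp add: emeasure_distr)
    also have "Pair y -` (A \<times> B) \<inter> space (\<kappa> y) = (if y \<in> A then B else {})"
      using sets.sets_into_space[OF \<open>B \<in> sets N\<close>] sets_eq_imp_space_eq[OF s] by auto
    finally show "emeasure (distr (\<kappa> y) (\<tau> \<Otimes>\<^sub>M N) (Pair y)) (A \<times> B) =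
        emeasure (\<kappa> y) B * indicator A y"
      by simp
  qed
  finally show "emeasure (\<tau> \<bind> (\<lambda>y. distr (\<kappa> y) (\<tau> \<Otimes>\<^sub>M N) (Pair y))) (A \<times> B) =
      (\<integral>\<^sup>+y\<in>A. emeasure (\<kappa> y) B \<partial>\<tau>)" .
qed

text \<open>The joint law constructed by drawing the base point first is the only measure with this
disintegration, and for it the formula is the integral of a monadic bind.\<close>
lemma nn_integral_disintegration:
  assumes d: "disintegration \<tau> N \<eta> \<kappa>" and h[measurable]: "h \<in> borel_measurable (\<tau> \<Otimes>\<^sub>M N)"
  shows "(\<integral>\<^sup>+z. h z \<partial>\<eta>) = (\<integral>\<^sup>+y. \<integral>\<^sup>+x. h (y, x) \<partial>\<kappa> y \<partial>\<tau>)"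
proof -
  note \<tau> = disintegrationD(3)[OF d]
  note \<kappa>[measurable] = disintegrationD(5)[OF d]
  have k: "(\<lambda>y. distr (\<kappa> y) (\<tau> \<Otimes>\<^sub>M N) (Pair y)) \<in> \<tau> \<rightarrow>\<^sub>M prob_algebra (\<tau> \<Otimes>\<^sub>M N)"
    by measurable
  have "\<eta> = \<tau> \<bind> (\<lambda>y. distr (\<kappa> y) (\<tau> \<Otimes>\<^sub>M N) (Pair y))"
    by (rule disintegration_determines_measure[OF d disintegration_bind[OF \<tau> \<kappa>]])
  then have "(\<integral>\<^sup>+z. h z \<partial>\<eta>) = (\<integral>\<^sup>+y. \<integral>\<^sup>+z. h z \<partial>distr (\<kappa> y) (\<tau> \<Otimes>\<^sub>M N) (Pair y) \<partial>\<tau>)"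
    using nn_integral_bind[OF h measurable_prob_algebraD[OF k]] by simp
  also have "\<dots> = (\<integral>\<^sup>+y. \<integral>\<^sup>+x. h (y, x) \<partial>\<kappa> y \<partial>\<tau>)"
  proof (rule nn_integral_cong)
    fix y assume y: "y \<in> space \<tau>"
    have s: "sets (\<kappa> y) = sets N"
      using measurable_space[OF \<kappa> y] by (simp add: space_prob_algebra)
    have "Pair y \<in> \<kappa> y \<rightarrow>\<^sub>M \<tau> \<Otimes>\<^sub>M N"
      using y by (simp add: measurable_cong_sets[OF s refl])
    then show "(\<integral>\<^sup>+z. h z \<partial>distr (\<kappa> y) (\<tau> \<Otimes>\<^sub>M N) (Pair y)) = (\<integral>\<^sup>+x. h (y, x) \<partial>\<kappa> y)"
      by (simp add: nn_integral_distr)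
  qed
  finally show ?thesis .
qed

text \<open>For a fixed second factor, both kernels are densities of one and the same measure on the base.\<close>
lemma disintegration_AE_unique:
  assumes 1: "disintegration \<tau> N \<eta> \<kappa>" and 2: "disintegration \<tau> N \<eta> \<kappa>'" and B: "B \<in> sets N"
  shows "AE y in \<tau>. emeasure (\<kappa> y) B = emeasure (\<kappa>' y) B"
proof -
  interpret prob_space \<tau> by (rule disintegrationD(3)[OF 1])
  have [measurable]: "\<kappa> \<in> \<tau> \<rightarrow>\<^sub>M subprob_algebra N" "\<kappa>' \<in> \<tau> \<rightarrow>\<^sub>M subprob_algebra N"
    using disintegrationD(5)[OF 1] disintegrationD(5)[OF 2] by (auto dest: measurable_prob_algebraD)
  have m[measurable]: "(\<lambda>y. emeasure (\<kappa> y) B) \<in> borel_measurable \<tau>"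
     "(\<lambda>y. emeasure (\<kappa>' y) B) \<in> borel_measurable \<tau>"
    using B by measurable
  have "density \<tau> (\<lambda>y. emeasure (\<kappa> y) B) = density \<tau> (\<lambda>y. emeasure (\<kappa>' y) B)"
    using disintegrationD(6)[OF 1 _ B] disintegrationD(6)[OF 2 _ B]
    by (intro measure_eqI) (auto simp: emeasure_density)
  then show ?thesis
    by (subst (asm) density_unique_iff) auto
qed

section \<open>Markov measures on path space\<close>

text \<open>The last condition of \<^const>\<open>markov_measure\<close>, freed from the normalisation and from the initial
law. It applies to finite measures such as \<open>density P (\<lambda>\<omega>. g (\<omega> 0))\<close>, which is
what the reversal of time below needs.\<close>
definition markov_property ::
  "'a measure \<Rightarrow> ('a \<Rightarrow> 'a measure) \<Rightarrow> (nat \<Rightarrow> 'a) measure \<Rightarrow> bool" where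
  "markov_property E p N \<longleftrightarrow> finite_measure N \<and> sets N = sets (path_space E) \<and>
     (\<forall>n. \<forall>A\<in>sets E. \<forall>C\<in>sets (PiM {..n} (\<lambda>_. E)).
        emeasure N {\<omega> \<in> space N. restrict \<omega> {..n} \<in> C \<and> \<omega> (Suc n) \<in> A} =
        (\<integral>\<^sup>+\<omega>\<in>{\<omega> \<in> space N. restrict \<omega> {..n} \<in> C}. emeasure (p (\<omega> n)) A \<partial>N))"

lemma measurable_restrict_path:
  "(\<lambda>\<omega>. restrict \<omega> J) \<in> path_space E \<rightarrow>\<^sub>M PiM J (\<lambda>_. E)"
  by (intro measurable_restrict_subset) auto

lemma measurable_shift:
  "(\<lambda>\<omega> n. \<omega> (Suc n)) \<in> path_space E \<rightarrow>\<^sub>M path_space E"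
  by (rule measurable_PiM_single') (auto simp: space_PiM)

lemma measurable_coordinate: "(\<lambda>\<omega>. \<omega> i) \<in> path_space E \<rightarrow>\<^sub>M E"
  by (rule measurable_component_singleton) simp

lemma measurable_restrict_pair:
  "(\<lambda>\<omega>. (restrict \<omega> {..n}, \<omega> (Suc n))) \<in> path_space E \<rightarrow>\<^sub>M PiM {..n} (\<lambda>_. E) \<Otimes>\<^sub>M E"
  by (intro measurable_Pair measurable_restrict_path measurable_coordinate)

lemma measurable_finite_coordinate:
  "i \<in> I \<Longrightarrow> (\<lambda>\<omega>. \<omega> i) \<in> PiM I (\<lambda>_. E) \<rightarrow>\<^sub>M E"
  by (rule measurable_component_singleton)

lemma measurable_emeasure_transition_prob:
  "transition_prob E p \<Longrightarrow> A \<in> sets E \<Longrightarrow> (\<lambda>a. emeasure (p a) A) \<in> borel_measurable E"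
  unfolding transition_prob_def by (rule measurable_emeasure_kernel)

lemma transition_prob_space:
  "transition_prob E p \<Longrightarrow> a \<in> space E \<Longrightarrow> sets (p a) = sets E"
  "transition_prob E p \<Longrightarrow> a \<in> space E \<Longrightarrow> prob_space (p a)"
  unfolding transition_prob_def by (fact kernel_space)+

text \<open>Both sides integrate \<open>H\<close> against an image of a weighted copy of \<open>N\<close>; the Markov property says that
the two weighted images agree on events.\<close>
lemma markov_property_nn_integral:
  assumes N: "markov_property E p N" and p: "transition_prob E p"
    and A: "A \<in> sets E" and H: "H \<in> borel_measurable (PiM {..n} (\<lambda>_. E))"
  shows "(\<integral>\<^sup>+\<omega>. H (restrict \<omega> {..n}) * indicator A (\<omega> (Suc n)) \<partial>N) =
    (\<integral>\<^sup>+\<omega>. H (restrict \<omega> {..n}) * emeasure (p (\<omega> n)) A \<partial>N)"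
proof -
  have sN: "sets N = sets (path_space E)"
    using N by (simp add: markov_property_def)
  let ?Q = "PiM {..n} (\<lambda>_. E)"
  let ?r = "\<lambda>\<omega>::nat \<Rightarrow> 'a. restrict \<omega> {..n}"
  have r: "?r \<in> N \<rightarrow>\<^sub>M ?Q"
    unfolding measurable_cong_sets[OF sN refl] by (rule measurable_restrict_path)
  have coord: "(\<lambda>\<omega>. \<omega> i) \<in> N \<rightarrow>\<^sub>M E" for i
    unfolding measurable_cong_sets[OF sN refl] by (rule measurable_coordinate)
  have next_in: "(\<lambda>\<omega>. indicator A (\<omega> (Suc n)) :: ennreal) \<in> borel_measurable N"
    by (rule measurable_compose[OF coord borel_measurable_indicator[OF A]])
  have pA: "(\<lambda>\<omega>. emeasure (p (\<omega> n)) A) \<in> borel_measurable N"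
    by (rule measurable_compose[OF coord measurable_emeasure_transition_prob[OF p A]])
  define D where "D w = distr (density N w) ?Q ?r" for w
  have D: "emeasure (D w) C = (\<integral>\<^sup>+\<omega>. w \<omega> * indicator {\<omega> \<in> space N. ?r \<omega> \<in> C} \<omega> \<partial>N)"
    if "w \<in> borel_measurable N" "C \<in> sets ?Q" for w C
  proof -
    have "emeasure (D w) C = emeasure (density N w) (?r -` C \<inter> space N)"
      using r that(2) by (simp add: D_def emeasure_distr)
    also have "?r -` C \<inter> space N = {\<omega> \<in> space N. ?r \<omega> \<in> C}"
      by blast
    also have "emeasure (density N w) \<dots> = (\<integral>\<^sup>+\<omega>. w \<omega> * indicator {\<omega> \<in> space N. ?r \<omega> \<in> C} \<omega> \<partial>N)"
      using that(1) sets_Collect_mem[OF r that(2)] by (rule emeasure_density)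
    finally show ?thesis .
  qed
  have "D (\<lambda>\<omega>. indicator A (\<omega> (Suc n))) = D (\<lambda>\<omega>. emeasure (p (\<omega> n)) A)"
  proof (rule measure_eqI)
    fix C assume "C \<in> sets (D (\<lambda>\<omega>. indicator A (\<omega> (Suc n))))"
    then have C: "C \<in> sets ?Q" by (simp add: D_def)
    have "emeasure (D (\<lambda>\<omega>. indicator A (\<omega> (Suc n)))) C =
        (\<integral>\<^sup>+\<omega>. indicator {\<omega> \<in> space N. ?r \<omega> \<in> C \<and> \<omega> (Suc n) \<in> A} \<omega> \<partial>N)"
      unfolding D[OF next_in C] by (intro nn_integral_cong) (simp split: split_indicator)
    also have "\<dots> = emeasure N {\<omega> \<in> space N. ?r \<omega> \<in> C \<and> \<omega> (Suc n) \<in> A}"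
      by (intro nn_integral_indicator sets.sets_Collect_conj sets_Collect_mem[OF r C] sets_Collect_mem[OF coord A])
    also have "\<dots> = (\<integral>\<^sup>+\<omega>\<in>{\<omega> \<in> space N. ?r \<omega> \<in> C}. emeasure (p (\<omega> n)) A \<partial>N)"
      using N C A unfolding markov_property_def by blast
    finally show "emeasure (D (\<lambda>\<omega>. indicator A (\<omega> (Suc n)))) C = emeasure (D (\<lambda>\<omega>. emeasure (p (\<omega> n)) A)) C"
      unfolding D[OF pA C] .
  qed (simp add: D_def)
  then have "(\<integral>\<^sup>+c. H c \<partial>D (\<lambda>\<omega>. indicator A (\<omega> (Suc n)))) = (\<integral>\<^sup>+c. H c \<partial>D (\<lambda>\<omega>. emeasure (p (\<omega> n)) A))"
    by (simp only:)
  moreover have "(\<integral>\<^sup>+c. H c \<partial>D w) = (\<integral>\<^sup>+\<omega>. H (?r \<omega>) * w \<omega> \<partial>N)"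
    if "w \<in> borel_measurable N" for w
    using that r H measurable_compose[OF r H]
    by (simp add: D_def nn_integral_distr nn_integral_density mult.commute)
  ultimately show ?thesis
    using next_in pA by (simp only:)
qed

text \<open>The kernel propagates the law of the coordinates \<open>0, \<dots>, n\<close> to that of \<open>0, \<dots>, n + 1\<close>, so the
initial law determines all finite-dimensional laws, hence the measure.\<close>
lemma markov_property_unique:
  assumes N1: "markov_property E p N1" and N2: "markov_property E p N2"
    and p: "transition_prob E p"
    and init: "distr N1 E (\<lambda>\<omega>. \<omega> 0) = distr N2 E (\<lambda>\<omega>. \<omega> 0)"
  shows "N1 = N2"
proof -
  have s1: "sets N1 = sets (path_space E)" and s2: "sets N2 = sets (path_space E)"
    and f1: "finite_measure N1"
    using N1 N2 by (auto simp: markov_property_def)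
  let ?Q = "\<lambda>n. PiM {..n} (\<lambda>_. E)"
  let ?r = "\<lambda>n (\<omega>::nat \<Rightarrow> 'a). restrict \<omega> {..n}"
  have law: "distr N1 (?Q n) (?r n) = distr N2 (?Q n) (?r n)" for n :: nat
  proof (induction n)
    case 0
    have law0: "distr N (?Q 0) (?r 0) = distr (distr N E (\<lambda>\<omega>. \<omega> 0)) (?Q 0) (\<lambda>x. \<lambda>i\<in>{..0}. x)"
      if "sets N = sets (path_space E)" for N
    proof -
      have r: "?r 0 = (\<lambda>x. \<lambda>i\<in>{..0}. x) \<circ> (\<lambda>\<omega>. \<omega> 0)"
        by (auto simp: fun_eq_iff restrict_def)
      have "(\<lambda>x. \<lambda>i\<in>{..0::nat}. x) \<in> E \<rightarrow>\<^sub>M ?Q 0"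
        by (intro measurable_restrict) simp
      moreover have "(\<lambda>\<omega>. \<omega> 0) \<in> N \<rightarrow>\<^sub>M E"
        unfolding measurable_cong_sets[OF that refl] by (rule measurable_coordinate)
      ultimately show ?thesis unfolding r by (rule distr_distr[symmetric])
    qed
    show ?case unfolding law0[OF s1] law0[OF s2] init ..
  next
    case (Suc n)
    have last: "(\<lambda>c. c n) \<in> ?Q n \<rightarrow>\<^sub>M E" by (rule measurable_component_singleton) simp
    have rect: "emeasure (distr N (?Q n \<Otimes>\<^sub>M E) (\<lambda>\<omega>. (?r n \<omega>, \<omega> (Suc n)))) (C \<times> A) =
        (\<integral>\<^sup>+c\<in>C. emeasure (p (c n)) A \<partial>distr N (?Q n) (?r n))"
      if N: "markov_property E p N" and CA[measurable]: "C \<in> sets (?Q n)" "A \<in> sets E" for N C A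
    proof -
      have sN: "sets N = sets (path_space E)"
        using N by (simp add: markov_property_def)
      have pA: "(\<lambda>c. emeasure (p (c n)) A) \<in> borel_measurable (?Q n)"
        using measurable_compose[OF last measurable_emeasure_transition_prob[OF p CA(2)]] .
      have "emeasure (distr N (?Q n \<Otimes>\<^sub>M E) (\<lambda>\<omega>. (?r n \<omega>, \<omega> (Suc n)))) (C \<times> A) =
          emeasure N {\<omega> \<in> space N. restrict \<omega> {..n} \<in> C \<and> \<omega> (Suc n) \<in> A}"
      proof -
        have "(\<lambda>\<omega>. (?r n \<omega>, \<omega> (Suc n))) -` (C \<times> A) \<inter> space N =
            {\<omega> \<in> space N. restrict \<omega> {..n} \<in> C \<and> \<omega> (Suc n) \<in> A}"
          by blast
        moreover have "(\<lambda>\<omega>. (?r n \<omega>, \<omega> (Suc n))) \<in> N \<rightarrow>\<^sub>M ?Q n \<Otimes>\<^sub>M E"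
          unfolding measurable_cong_sets[OF sN refl] by (rule measurable_restrict_pair)
        ultimately show ?thesis by (simp only: emeasure_distr pair_measureI CA)
      qed
      also have "\<dots> = (\<integral>\<^sup>+\<omega>\<in>{\<omega> \<in> space N. ?r n \<omega> \<in> C}. emeasure (p (\<omega> n)) A \<partial>N)"
        using N CA unfolding markov_property_def by blast
      also have "\<dots> = (\<integral>\<^sup>+\<omega>. emeasure (p (?r n \<omega> n)) A * indicator C (?r n \<omega>) \<partial>N)"
        by (intro nn_integral_cong) (simp split: split_indicator)
      also have "\<dots> = (\<integral>\<^sup>+c\<in>C. emeasure (p (c n)) A \<partial>distr N (?Q n) (?r n))"
      proof -
        have "?r n \<in> N \<rightarrow>\<^sub>M ?Q n"
          unfolding measurable_cong_sets[OF sN refl] by (rule measurable_restrict_path)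
        moreover have "(\<lambda>c. emeasure (p (c n)) A * indicator C c) \<in> borel_measurable (?Q n)"
          by (intro borel_measurable_times_ennreal borel_measurable_indicator CA pA)
        ultimately show ?thesis by (simp only: nn_integral_distr measurable_distr_eq1)
      qed
      finally show ?thesis .
    qed
    have pair: "distr N1 (?Q n \<Otimes>\<^sub>M E) (\<lambda>\<omega>. (?r n \<omega>, \<omega> (Suc n))) =
        distr N2 (?Q n \<Otimes>\<^sub>M E) (\<lambda>\<omega>. (?r n \<omega>, \<omega> (Suc n)))"
    proof (rule measure_eqI_rectangles[where Y = "?Q n" and N = E])
      show "finite_measure (distr N1 (?Q n \<Otimes>\<^sub>M E) (\<lambda>\<omega>. (?r n \<omega>, \<omega> (Suc n))))"
        by (rule finite_measure.finite_measure_distr[OF f1])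
           (unfold measurable_cong_sets[OF s1 refl], rule measurable_restrict_pair)
    qed (simp_all only: rect[OF N1] rect[OF N2] Suc.IH sets_distr)
    have upd[measurable]: "(\<lambda>(c, x). c(Suc n := x)) \<in> ?Q n \<Otimes>\<^sub>M E \<rightarrow>\<^sub>M ?Q (Suc n)"
    proof -
      have "(\<lambda>(c, x). c(Suc n := x)) \<in> ?Q n \<Otimes>\<^sub>M E \<rightarrow>\<^sub>M PiM (insert (Suc n) {..n}) (\<lambda>_. E)"
        by (rule measurable_add_dim)
      then show ?thesis by (simp only: atMost_Suc)
    qed
    have lawSuc: "distr N (?Q (Suc n)) (?r (Suc n)) =
        distr (distr N (?Q n \<Otimes>\<^sub>M E) (\<lambda>\<omega>. (?r n \<omega>, \<omega> (Suc n)))) (?Q (Suc n)) (\<lambda>(c, x). c(Suc n := x))"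
      if "sets N = sets (path_space E)" for N
    proof -
      have r: "?r (Suc n) = (\<lambda>(c, x). c(Suc n := x)) \<circ> (\<lambda>\<omega>. (?r n \<omega>, \<omega> (Suc n)))"
        by (auto simp: fun_eq_iff restrict_def)
      have "(\<lambda>\<omega>. (?r n \<omega>, \<omega> (Suc n))) \<in> N \<rightarrow>\<^sub>M ?Q n \<Otimes>\<^sub>M E"
        unfolding measurable_cong_sets[OF that refl] by (rule measurable_restrict_pair)
      then show ?thesis unfolding r by (rule distr_distr[OF upd, symmetric])
    qed
    show ?case unfolding lawSuc[OF s1] lawSuc[OF s2] pair ..
  qed
  show ?thesis
  proof (rule measure_eqI_PiM_infinite[OF s1 s2])
    show "finite_measure N1" by fact
    fix A and J :: "nat set"
    assume J: "finite J" "J \<subseteq> UNIV" and A: "\<And>i. i \<in> J \<Longrightarrow> A i \<in> sets E"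
    obtain n where n: "J \<subseteq> {..n}"
      using finite_nat_bounded[OF J(1)] by (auto simp: lessThan_Suc_atMost dest: less_imp_le)
    define C where "C = prod_emb {..n} (\<lambda>_. E) J (Pi\<^sub>E J A)"
    have C[measurable]: "C \<in> sets (?Q n)"
      unfolding C_def using n J A by (intro sets_PiM_I) auto
    have cyl: "emeasure N (prod_emb UNIV (\<lambda>_. E) J (Pi\<^sub>E J A)) = emeasure (distr N (?Q n) (?r n)) C"
      if sN: "sets N = sets (path_space E)" for N
    proof -
      have "?r n \<in> N \<rightarrow>\<^sub>M ?Q n"
        unfolding measurable_cong_sets[OF sN refl] by (rule measurable_restrict_path)
      moreover have "?r n -` C \<inter> space N = prod_emb UNIV (\<lambda>_. E) J (Pi\<^sub>E J A)"
      proof -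
        have rr: "restrict (restrict \<omega> {..n}) J = restrict \<omega> J" for \<omega> :: "nat \<Rightarrow> 'a"
          using n by (simp only: restrict_restrict Int_absorb1)
        have "restrict \<omega> {..n} \<in> (\<Pi>\<^sub>E i\<in>{..n}. space E)" if "\<omega> \<in> (\<Pi>\<^sub>E i\<in>UNIV. space E)" for \<omega> :: "nat \<Rightarrow> 'a"
          using that by (simp add: restrict_PiE_iff PiE_iff)
        then show ?thesis
          unfolding C_def sets_eq_imp_space_eq[OF sN] prod_emb_def vimage_def space_PiM mem_Collect_eq Int_iff rr
          by blast
      qed
      ultimately show ?thesis by (simp only: emeasure_distr C)
    qed
    show "emeasure N1 (prod_emb UNIV (\<lambda>_. E) J (Pi\<^sub>E J A)) = emeasure N2 (prod_emb UNIV (\<lambda>_. E) J (Pi\<^sub>E J A))"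
      unfolding cyl[OF s1] cyl[OF s2] law ..
  qed
qed

text \<open>Stationarity of \<open>m\<close>, hence shift invariance of \<open>P\<close>, is contained in duality: it is the case
\<open>B = space E\<close>.\<close>
locale markov_chain =
  fixes E :: "'e measure" and p q :: "'e \<Rightarrow> 'e measure" and m :: "'e measure"
    and P :: "(nat \<Rightarrow> 'e) measure"
  assumes p: "transition_prob E p" and P: "markov_measure E p m P"
    and q: "in_duality E m p q"
begin

lemma transition_q: "transition_prob E q"
  using q by (simp add: in_duality_def)

lemma dual: "A \<in> sets E \<Longrightarrow> B \<in> sets E \<Longrightarrow>
    (\<integral>\<^sup>+a\<in>B. emeasure (p a) A \<partial>m) = (\<integral>\<^sup>+b\<in>A. emeasure (q b) B \<partial>m)"
  using q by (simp add: in_duality_def)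

lemma sets_P[measurable_cong]: "sets P = sets (path_space E)"
  and prob_P: "prob_space P"
  and markov_P: "markov_property E p P"
  and distr_initial: "distr P E (\<lambda>\<omega>. \<omega> 0) = m"
  using P by (auto simp: markov_measure_def markov_property_def space_prob_algebra prob_space.finite_measure)

lemma coordinate: "(\<lambda>\<omega>. \<omega> i) \<in> P \<rightarrow>\<^sub>M E"
  unfolding measurable_cong_sets[OF sets_P refl] by (rule measurable_coordinate)

lemma shift: "(\<lambda>\<omega> n. \<omega> (Suc n)) \<in> P \<rightarrow>\<^sub>M path_space E"
  unfolding measurable_cong_sets[OF sets_P refl] by (rule measurable_shift)

lemma sets_m[measurable_cong]: "sets m = sets E"
  using arg_cong[OF distr_initial, of sets] by simp

lemma prob_m: "prob_space m"
  using prob_space.prob_space_distr[OF prob_P coordinate[of 0]] by (simp only: distr_initial)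

lemma nn_integral_initial_coordinate:
  assumes "g \<in> borel_measurable E"
  shows "(\<integral>\<^sup>+\<omega>. g (\<omega> 0) \<partial>P) = (\<integral>\<^sup>+a. g a \<partial>m)"
  unfolding distr_initial[symmetric] using assms coordinate by (subst nn_integral_distr) auto

lemma next_given_initial:
  "disintegration m E (distr P (E \<Otimes>\<^sub>M E) (\<lambda>\<omega>. (\<omega> 0, \<omega> 1))) p"
proof (rule disintegrationI[OF prob_m])
  show "sets (distr P (E \<Otimes>\<^sub>M E) (\<lambda>\<omega>. (\<omega> 0, \<omega> 1))) = sets (m \<Otimes>\<^sub>M E)"
    by (simp add: sets_m cong: sets_pair_measure_cong)
  show "p \<in> m \<rightarrow>\<^sub>M prob_algebra E"
    using p by (simp add: transition_prob_def measurable_cong_sets[OF sets_m refl])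
  fix A B assume "A \<in> sets m" and B: "B \<in> sets E"
  then have A: "A \<in> sets E" by (simp add: sets_m)
  have meas: "(\<lambda>\<omega>. (\<omega> 0, \<omega> 1)) \<in> P \<rightarrow>\<^sub>M E \<Otimes>\<^sub>M E"
    by (intro measurable_Pair coordinate)
  have "emeasure (distr P (E \<Otimes>\<^sub>M E) (\<lambda>\<omega>. (\<omega> 0, \<omega> 1))) (A \<times> B) =
      (\<integral>\<^sup>+\<omega>. indicator (A \<times> B) (\<omega> 0, \<omega> 1) \<partial>P)"
    using A B by (intro emeasure_distr_nn_integral[OF meas]) simp
  also have "\<dots> = (\<integral>\<^sup>+\<omega>. indicator A (restrict \<omega> {..0::nat} 0) * indicator B (\<omega> (Suc 0)) \<partial>P)"
    by (intro nn_integral_cong) (simp split: split_indicator)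
  also have "\<dots> = (\<integral>\<^sup>+\<omega>. indicator A (restrict \<omega> {..0::nat} 0) * emeasure (p (\<omega> 0)) B \<partial>P)"
    using A by (intro markov_property_nn_integral[where H = "\<lambda>c. indicator A (c 0)", OF markov_P p B]) 
     (auto intro!: measurable_compose[OF measurable_component_singleton])
  also have "\<dots> = (\<integral>\<^sup>+\<omega>. emeasure (p (\<omega> 0)) B * indicator A (\<omega> 0) \<partial>P)"
    by (intro nn_integral_cong) (simp split: split_indicator)
  also have "\<dots> = (\<integral>\<^sup>+a\<in>A. emeasure (p a) B \<partial>m)"
    using measurable_emeasure_transition_prob[OF p B] A by (intro nn_integral_initial_coordinate) auto
  finally show "emeasure (distr P (E \<Otimes>\<^sub>M E) (\<lambda>\<omega>. (\<omega> 0, \<omega> 1))) (A \<times> B) = \<dots>" .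
qed

text \<open>Duality of \<open>p\<close> and \<open>q\<close>, expressed by the joint law of the first two coordinates: its two
disintegrations have the kernels \<open>p\<close> and \<open>q\<close>.\<close>
lemma initial_given_next:
  "disintegration m E (distr P (E \<Otimes>\<^sub>M E) (\<lambda>\<omega>. (\<omega> 1, \<omega> 0))) q"
proof (rule disintegrationI[OF prob_m])
  show "sets (distr P (E \<Otimes>\<^sub>M E) (\<lambda>\<omega>. (\<omega> 1, \<omega> 0))) = sets (m \<Otimes>\<^sub>M E)"
    by (simp add: sets_m cong: sets_pair_measure_cong)
  show "q \<in> m \<rightarrow>\<^sub>M prob_algebra E"
    using transition_q by (simp add: transition_prob_def measurable_cong_sets[OF sets_m refl])
  fix A B assume "A \<in> sets m" and B: "B \<in> sets E"
  then have A: "A \<in> sets E" by (simp add: sets_m)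
  have meas: "(\<lambda>\<omega>. (\<omega> i, \<omega> j)) \<in> P \<rightarrow>\<^sub>M E \<Otimes>\<^sub>M E" for i j
    by (intro measurable_Pair coordinate)
  have "emeasure (distr P (E \<Otimes>\<^sub>M E) (\<lambda>\<omega>. (\<omega> 1, \<omega> 0))) (A \<times> B) =
    emeasure P ((\<lambda>\<omega>. (\<omega> 1, \<omega> 0)) -` (A \<times> B) \<inter> space P)"
    using A B meas by (intro emeasure_distr) auto
  also have "(\<lambda>\<omega>. (\<omega> 1, \<omega> 0)) -` (A \<times> B) \<inter> space P = (\<lambda>\<omega>. (\<omega> 0, \<omega> 1)) -` (B \<times> A) \<inter> space P"
    by auto
  also have "emeasure P \<dots> = emeasure (distr P (E \<Otimes>\<^sub>M E) (\<lambda>\<omega>. (\<omega> 0, \<omega> 1))) (B \<times> A)"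
    using A B meas by (intro emeasure_distr[symmetric]) auto
  also have "\<dots> = (\<integral>\<^sup>+a\<in>B. emeasure (p a) A \<partial>m)"
    using A B by (intro disintegrationD(6)[OF next_given_initial]) (auto simp: sets_m)
  also have "\<dots> = (\<integral>\<^sup>+b\<in>A. emeasure (q b) B \<partial>m)"
    by (rule dual[OF A B])
  finally show "emeasure (distr P (E \<Otimes>\<^sub>M E) (\<lambda>\<omega>. (\<omega> 1, \<omega> 0))) (A \<times> B) = \<dots>" .
qed

text \<open>A weight that depends on \<open>\<omega> 0\<close> alone is known at every later time. It can therefore be absorbed into
the integrand \<open>H\<close> of the Markov property of \<open>P\<close>, and the future after time \<open>0\<close> remains a
\<open>p\<close>-chain under the weighted measure.\<close>
lemma markov_property_shift_density:
  assumes g: "g \<in> borel_measurable E" and le: "\<And>a. g a \<le> (1 :: ennreal)"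
  shows "markov_property E p (distr (density P (\<lambda>\<omega>. g (\<omega> 0))) (path_space E) (\<lambda>\<omega> n. \<omega> (Suc n)))"
    (is "markov_property E p ?N")
  unfolding markov_property_def
proof (intro conjI allI ballI)
  let ?s = "\<lambda>\<omega> n. \<omega> (Suc n) :: 'e"
  have g0: "(\<lambda>\<omega>. g (\<omega> 0)) \<in> borel_measurable P"
    by (rule measurable_compose[OF coordinate g])
  have int: "(\<integral>\<^sup>+\<omega>. h \<omega> \<partial>?N) = (\<integral>\<^sup>+\<omega>. g (\<omega> 0) * h (?s \<omega>) \<partial>P)"
    if "h \<in> borel_measurable (path_space E)" for h
    using that shift measurable_compose[OF shift that] g0
    by (simp add: nn_integral_distr nn_integral_density)
  show "sets ?N = sets (path_space E)" by simp
  show "finite_measure ?N"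
  proof (rule finite_measureI)
    have "emeasure ?N (space ?N) = (\<integral>\<^sup>+\<omega>. 1 \<partial>?N)" by simp
    also have "\<dots> = (\<integral>\<^sup>+\<omega>. g (\<omega> 0) * 1 \<partial>P)" by (rule int) simp
    also have "\<dots> \<le> (\<integral>\<^sup>+\<omega>. 1 \<partial>P)" by (intro nn_integral_mono) (simp add: le)
    also have "\<dots> = 1" using prob_space.emeasure_space_1[OF prob_P] by simp
    finally show "emeasure ?N (space ?N) \<noteq> \<infinity>" by (auto simp: top_unique)
  qed
  fix n :: nat and A C assume A: "A \<in> sets E" and C: "C \<in> sets (PiM {..n} (\<lambda>_. E))"
  have r: "(\<lambda>\<omega>. restrict \<omega> {..n}) \<in> path_space E \<rightarrow>\<^sub>M PiM {..n} (\<lambda>_. E)"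
    by (rule measurable_restrict_path)
  have sp: "space ?N = space (path_space E)" by simp
  have CA: "{\<omega> \<in> space ?N. restrict \<omega> {..n} \<in> C} \<in> sets (path_space E)"
    "{\<omega> \<in> space ?N. restrict \<omega> {..n} \<in> C \<and> \<omega> (Suc n) \<in> A} \<in> sets (path_space E)"
    unfolding sp by (intro sets.sets_Collect_conj sets_Collect_mem[OF r C] sets_Collect_mem[OF measurable_coordinate A])+
  \<comment> \<open>Seen from \<open>P\<close>, the event at times \<open>0, \<dots>, n\<close> of the shifted path lives at times
    \<open>1, \<dots>, n + 1\<close>, and time \<open>0\<close> is free to carry the weight.\<close>
  define H where "H = (\<lambda>c. g (c 0) * indicator C (\<lambda>i\<in>{..n}. c (Suc i) :: 'e))"
  have H: "H \<in> borel_measurable (PiM {..Suc n} (\<lambda>_. E))"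
  proof -
    have "(\<lambda>c. \<lambda>i\<in>{..n}. c (Suc i)) \<in> PiM {..Suc n} (\<lambda>_. E) \<rightarrow>\<^sub>M PiM {..n} (\<lambda>_. E)"
      by (intro measurable_restrict measurable_component_singleton) simp
    from measurable_compose[OF this borel_measurable_indicator[OF C]]
    show ?thesis unfolding H_def
      by (intro borel_measurable_times_ennreal measurable_compose[OF measurable_finite_coordinate g]) auto
  qed
  have HS: "H (restrict \<omega> {..Suc n}) = g (\<omega> 0) * indicator C (restrict (?s \<omega>) {..n})" for \<omega>
  proof -
    have "(\<lambda>i\<in>{..n}. restrict \<omega> {..Suc n} (Suc i)) = restrict (?s \<omega>) {..n}" by auto
    then show ?thesis by (simp add: H_def)
  qed
  have sps: "?s \<omega> \<in> space ?N" if "\<omega> \<in> space P" for \<omega>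
    using measurable_space[OF shift that] by simp
  have "emeasure ?N {\<omega> \<in> space ?N. restrict \<omega> {..n} \<in> C \<and> \<omega> (Suc n) \<in> A} =
      (\<integral>\<^sup>+\<omega>. indicator {\<omega> \<in> space ?N. restrict \<omega> {..n} \<in> C \<and> \<omega> (Suc n) \<in> A} \<omega> \<partial>?N)"
    using CA by (intro nn_integral_indicator[symmetric]) (simp only: sets_distr)
  also have "\<dots> = (\<integral>\<^sup>+\<omega>. g (\<omega> 0) * indicator {\<omega> \<in> space ?N. restrict \<omega> {..n} \<in> C \<and> \<omega> (Suc n) \<in> A} (?s \<omega>) \<partial>P)"
    by (rule int[OF borel_measurable_indicator[OF CA(2)]])
  also have "\<dots> = (\<integral>\<^sup>+\<omega>. H (restrict \<omega> {..Suc n}) * indicator A (\<omega> (Suc (Suc n))) \<partial>P)"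
    unfolding HS using sps by (intro nn_integral_cong) (simp split: split_indicator)
  also have "\<dots> = (\<integral>\<^sup>+\<omega>. H (restrict \<omega> {..Suc n}) * emeasure (p (\<omega> (Suc n))) A \<partial>P)"
    by (rule markov_property_nn_integral[OF markov_P p A H])
  also have "\<dots> = (\<integral>\<^sup>+\<omega>. g (\<omega> 0) * (emeasure (p (?s \<omega> n)) A * indicator {\<omega> \<in> space ?N. restrict \<omega> {..n} \<in> C} (?s \<omega>)) \<partial>P)"
    unfolding HS using sps by (intro nn_integral_cong) (simp split: split_indicator)
  also have "\<dots> = (\<integral>\<^sup>+\<omega>\<in>{\<omega> \<in> space ?N. restrict \<omega> {..n} \<in> C}. emeasure (p (\<omega> n)) A \<partial>?N)"
    by (rule int[symmetric])
      (intro borel_measurable_times_ennreal borel_measurable_indicator CA(1)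
        measurable_compose[OF measurable_coordinate measurable_emeasure_transition_prob[OF p A]])
  finally show "emeasure ?N {\<omega> \<in> space ?N. restrict \<omega> {..n} \<in> C \<and> \<omega> (Suc n) \<in> A} = \<dots>" .
qed

text \<open>The weight is a factor of \<open>H\<close>, as before, now without a shift of time.\<close>
lemma markov_property_density:
  assumes g: "g \<in> borel_measurable E" and le: "\<And>a. a \<in> space E \<Longrightarrow> g a \<le> (1 :: ennreal)"
  shows "markov_property E p (density P (\<lambda>\<omega>. g (\<omega> 0)))"
    (is "markov_property E p ?N")
  unfolding markov_property_def
proof (intro conjI allI ballI)
  have g0: "(\<lambda>\<omega>. g (\<omega> 0)) \<in> borel_measurable P"
    by (rule measurable_compose[OF coordinate g])
  have int: "(\<integral>\<^sup>+\<omega>. h \<omega> \<partial>?N) = (\<integral>\<^sup>+\<omega>. g (\<omega> 0) * h \<omega> \<partial>P)"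
    if "h \<in> borel_measurable P" for h
    using that g0 by (simp add: nn_integral_density)
  show "sets ?N = sets (path_space E)" by (simp add: sets_P)
  show "finite_measure ?N"
  proof (rule finite_measureI)
    have "emeasure ?N (space ?N) = (\<integral>\<^sup>+\<omega>. 1 \<partial>?N)" by simp
    also have "\<dots> = (\<integral>\<^sup>+\<omega>. g (\<omega> 0) * 1 \<partial>P)" by (rule int) simp
    also have "\<dots> \<le> (\<integral>\<^sup>+\<omega>. 1 \<partial>P)"
      using measurable_space[OF coordinate] by (intro nn_integral_mono) (simp add: le)
    also have "\<dots> = 1" using prob_space.emeasure_space_1[OF prob_P] by simp
    finally show "emeasure ?N (space ?N) \<noteq> \<infinity>" by (auto simp: top_unique)
  qed
  fix n :: nat and A C assume A: "A \<in> sets E" and C: "C \<in> sets (PiM {..n} (\<lambda>_. E))"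
  have r: "(\<lambda>\<omega>. restrict \<omega> {..n}) \<in> P \<rightarrow>\<^sub>M PiM {..n} (\<lambda>_. E)"
    unfolding measurable_cong_sets[OF sets_P refl] by (rule measurable_restrict_path)
  have sp: "space ?N = space P" by simp
  have CA: "{\<omega> \<in> space ?N. restrict \<omega> {..n} \<in> C} \<in> sets P"
    "{\<omega> \<in> space ?N. restrict \<omega> {..n} \<in> C \<and> \<omega> (Suc n) \<in> A} \<in> sets P"
    unfolding sp by (intro sets.sets_Collect_conj sets_Collect_mem[OF r C] sets_Collect_mem[OF coordinate A])+
  define H where "H = (\<lambda>c. g (c 0) * indicator C (c :: nat \<Rightarrow> 'e))"
  have H: "H \<in> borel_measurable (PiM {..n} (\<lambda>_. E))"
    unfolding H_def using C
    by (intro borel_measurable_times_ennreal borel_measurable_indicator measurable_compose[OF measurable_finite_coordinate g]) auto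
  have HS: "H (restrict \<omega> {..n}) = g (\<omega> 0) * indicator C (restrict \<omega> {..n})" for \<omega>
    by (simp add: H_def)
  have "emeasure ?N {\<omega> \<in> space ?N. restrict \<omega> {..n} \<in> C \<and> \<omega> (Suc n) \<in> A} =
      (\<integral>\<^sup>+\<omega>. indicator {\<omega> \<in> space ?N. restrict \<omega> {..n} \<in> C \<and> \<omega> (Suc n) \<in> A} \<omega> \<partial>?N)"
    using CA by (intro nn_integral_indicator[symmetric]) (simp only: sets_density)
  also have "\<dots> = (\<integral>\<^sup>+\<omega>. g (\<omega> 0) * indicator {\<omega> \<in> space ?N. restrict \<omega> {..n} \<in> C \<and> \<omega> (Suc n) \<in> A} \<omega> \<partial>P)"
    by (rule int[OF borel_measurable_indicator[OF CA(2)]])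
  also have "\<dots> = (\<integral>\<^sup>+\<omega>. H (restrict \<omega> {..n}) * indicator A (\<omega> (Suc n)) \<partial>P)"
    unfolding HS by (intro nn_integral_cong) (simp split: split_indicator)
  also have "\<dots> = (\<integral>\<^sup>+\<omega>. H (restrict \<omega> {..n}) * emeasure (p (\<omega> n)) A \<partial>P)"
    by (rule markov_property_nn_integral[OF markov_P p A H])
  also have "\<dots> = (\<integral>\<^sup>+\<omega>. g (\<omega> 0) * (emeasure (p (\<omega> n)) A * indicator {\<omega> \<in> space ?N. restrict \<omega> {..n} \<in> C} \<omega>) \<partial>P)"
    unfolding HS by (intro nn_integral_cong) (simp split: split_indicator)
  also have "\<dots> = (\<integral>\<^sup>+\<omega>\<in>{\<omega> \<in> space ?N. restrict \<omega> {..n} \<in> C}. emeasure (p (\<omega> n)) A \<partial>?N)"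
    by (rule int[symmetric])
      (intro borel_measurable_times_ennreal borel_measurable_indicator CA(1)
        measurable_compose[OF coordinate measurable_emeasure_transition_prob[OF p A]])
  finally show "emeasure ?N {\<omega> \<in> space ?N. restrict \<omega> {..n} \<in> C \<and> \<omega> (Suc n) \<in> A} = \<dots>" .
qed

text \<open>For an event \<open>\<omega> 0 \<in> B\<close>, two measures on the future have to be compared: the law of the shifted
path restricted to \<open>\<omega> 0 \<in> B\<close>, and \<open>P\<close> with density \<open>q (\<omega> 0) B\<close>. Both are \<open>p\<close>-chains, and duality says
that they start with the same initial law.\<close>
lemma past_given_future:
  "disintegration P E (distr P (path_space E \<Otimes>\<^sub>M E) (\<lambda>\<omega>. (\<lambda>n. \<omega> (Suc n), \<omega> 0))) (\<lambda>\<omega>. q (\<omega> 0))"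
proof (rule disintegrationI[OF prob_P])
  let ?s = "\<lambda>\<omega> n. \<omega> (Suc n) :: 'e"
  show "sets (distr P (path_space E \<Otimes>\<^sub>M E) (\<lambda>\<omega>. (?s \<omega>, \<omega> 0))) = sets (P \<Otimes>\<^sub>M E)"
    by (simp add: sets_P cong: sets_pair_measure_cong)
  show "(\<lambda>\<omega>. q (\<omega> 0)) \<in> P \<rightarrow>\<^sub>M prob_algebra E"
    using transition_q unfolding transition_prob_def by (rule measurable_compose[OF coordinate])
  fix C B assume C': "C \<in> sets P" and B: "B \<in> sets E"
  then have C: "C \<in> sets (path_space E)" by (simp only: sets_P)
  define g where "g = (indicator B :: 'e \<Rightarrow> ennreal)"
  define g' where "g' b = emeasure (q b) B" for b
  have g: "g \<in> borel_measurable E" using B by (simp add: g_def)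
  have g': "g' \<in> borel_measurable E"
    using measurable_emeasure_transition_prob[OF transition_q B] by (simp add: g'_def[abs_def])
  have g0: "(\<lambda>\<omega>. g (\<omega> 0)) \<in> borel_measurable P"
    by (rule measurable_compose[OF coordinate g])
  have g0': "(\<lambda>\<omega>. g' (\<omega> 0)) \<in> borel_measurable P"
    by (rule measurable_compose[OF coordinate g'])
  have g_le: "g a \<le> 1" for a by (simp add: g_def split: split_indicator)
  have g'_le: "g' a \<le> 1" if "a \<in> space E" for a
    using prob_space.emeasure_le_1[OF transition_prob_space(2)[OF transition_q that]] by (simp add: g'_def)
  let ?N1 = "distr (density P (\<lambda>\<omega>. g (\<omega> 0))) (path_space E) ?s"
  let ?N2 = "density P (\<lambda>\<omega>. g' (\<omega> 0))"
  have s': "?s \<in> density P (\<lambda>\<omega>. g (\<omega> 0)) \<rightarrow>\<^sub>M path_space E"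
    using shift by simp
  have pair: "(\<lambda>\<omega>. (\<omega> 1, \<omega> 0)) \<in> P \<rightarrow>\<^sub>M E \<Otimes>\<^sub>M E"
    by (intro measurable_Pair coordinate)
  have pairs: "(\<lambda>\<omega>. (?s \<omega>, \<omega> 0)) \<in> P \<rightarrow>\<^sub>M path_space E \<Otimes>\<^sub>M E"
    by (intro measurable_Pair coordinate shift)
  have "?N1 = ?N2"
  proof (rule markov_property_unique[OF _ _ p])
    show "markov_property E p ?N1"
      by (rule markov_property_shift_density[OF g g_le])
    show "markov_property E p ?N2"
      by (rule markov_property_density[OF g' g'_le])
    have "distr ?N1 E (\<lambda>\<omega>. \<omega> 0) = distr (density P (\<lambda>\<omega>. g (\<omega> 0))) E ((\<lambda>\<omega>. \<omega> 0) \<circ> ?s)"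
      by (rule distr_distr[OF measurable_coordinate s'])
    also have "\<dots> = distr ?N2 E (\<lambda>\<omega>. \<omega> 0)"
    proof (rule measure_eqI)
      fix A assume "A \<in> sets (distr (density P (\<lambda>\<omega>. g (\<omega> 0))) E ((\<lambda>\<omega>. \<omega> 0) \<circ> ?s))"
      then have A: "A \<in> sets E" by simp
      have c1: "((\<lambda>\<omega>. \<omega> 0) \<circ> ?s) \<in> density P (\<lambda>\<omega>. g (\<omega> 0)) \<rightarrow>\<^sub>M E"
        using coordinate[of "Suc 0"] by (simp add: comp_def)
      have c0: "(\<lambda>\<omega>. \<omega> 0) \<in> density P (\<lambda>\<omega>. g' (\<omega> 0)) \<rightarrow>\<^sub>M E"
        using coordinate by simp
      have "emeasure (distr (density P (\<lambda>\<omega>. g (\<omega> 0))) E ((\<lambda>\<omega>. \<omega> 0) \<circ> ?s)) A =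
          emeasure (density P (\<lambda>\<omega>. g (\<omega> 0))) (((\<lambda>\<omega>. \<omega> 0) \<circ> ?s) -` A \<inter> space P)"
        using emeasure_distr[OF c1 A] by simp
      also have "((\<lambda>\<omega>. \<omega> 0) \<circ> ?s) -` A \<inter> space P = {\<omega> \<in> space P. \<omega> 1 \<in> A}"
        by auto
      also have "emeasure (density P (\<lambda>\<omega>. g (\<omega> 0))) \<dots> =
          (\<integral>\<^sup>+\<omega>. g (\<omega> 0) * indicator {\<omega> \<in> space P. \<omega> 1 \<in> A} \<omega> \<partial>P)"
        by (rule emeasure_density[OF g0 sets_Collect_mem[OF coordinate A]])
      also have "\<dots> = (\<integral>\<^sup>+\<omega>. indicator (A \<times> B) (\<omega> 1, \<omega> 0) \<partial>P)"
        by (intro nn_integral_cong) (simp add: g_def split: split_indicator)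
      also have "\<dots> = emeasure (distr P (E \<Otimes>\<^sub>M E) (\<lambda>\<omega>. (\<omega> 1, \<omega> 0))) (A \<times> B)"
        using A B by (intro emeasure_distr_nn_integral[OF pair, symmetric]) simp
      also have "\<dots> = (\<integral>\<^sup>+b\<in>A. g' b \<partial>m)"
        unfolding g'_def using A B by (intro disintegrationD(6)[OF initial_given_next]) (auto simp: sets_m)
      also have "\<dots> = (\<integral>\<^sup>+\<omega>. g' (\<omega> 0) * indicator A (\<omega> 0) \<partial>P)"
        using g' A by (intro nn_integral_initial_coordinate[symmetric]) auto
      also have "\<dots> = (\<integral>\<^sup>+\<omega>. g' (\<omega> 0) * indicator {\<omega> \<in> space P. \<omega> 0 \<in> A} \<omega> \<partial>P)"
        by (intro nn_integral_cong) (simp split: split_indicator)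
      also have "\<dots> = emeasure ?N2 {\<omega> \<in> space P. \<omega> 0 \<in> A}"
        by (rule emeasure_density[OF g0' sets_Collect_mem[OF coordinate A], symmetric])
      also have "{\<omega> \<in> space P. \<omega> 0 \<in> A} = (\<lambda>\<omega>. \<omega> 0) -` A \<inter> space ?N2"
        by auto
      also have "emeasure ?N2 \<dots> = emeasure (distr ?N2 E (\<lambda>\<omega>. \<omega> 0)) A"
        by (rule emeasure_distr[OF c0 A, symmetric])
      finally show "emeasure (distr (density P (\<lambda>\<omega>. g (\<omega> 0))) E ((\<lambda>\<omega>. \<omega> 0) \<circ> ?s)) A = \<dots>" .
    qed simp
    finally show "distr ?N1 E (\<lambda>\<omega>. \<omega> 0) = distr ?N2 E (\<lambda>\<omega>. \<omega> 0)" .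
  qed
  have "emeasure (distr P (path_space E \<Otimes>\<^sub>M E) (\<lambda>\<omega>. (?s \<omega>, \<omega> 0))) (C \<times> B) =
      (\<integral>\<^sup>+\<omega>. indicator (C \<times> B) (?s \<omega>, \<omega> 0) \<partial>P)"
    using C B by (intro emeasure_distr_nn_integral[OF pairs]) simp
  also have "\<dots> = (\<integral>\<^sup>+\<omega>. g (\<omega> 0) * indicator C (?s \<omega>) \<partial>P)"
    by (intro nn_integral_cong) (simp add: g_def split: split_indicator)
  also have "\<dots> = (\<integral>\<^sup>+\<omega>. indicator C (?s \<omega>) \<partial>density P (\<lambda>\<omega>. g (\<omega> 0)))"
    using g0 measurable_compose[OF shift borel_measurable_indicator[OF C]]
    by (intro nn_integral_density[symmetric])
  also have "\<dots> = (\<integral>\<^sup>+\<omega>. indicator C \<omega> \<partial>?N1)"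
    using s' C by (intro nn_integral_distr[symmetric]) auto
  also have "\<dots> = emeasure ?N2 C"
    unfolding \<open>?N1 = ?N2\<close> using C' by simp
  also have "\<dots> = (\<integral>\<^sup>+\<omega>\<in>C. emeasure (q (\<omega> 0)) B \<partial>P)"
    using emeasure_density[OF g0' C'] by (simp add: g'_def)
  finally show "emeasure (distr P (path_space E \<Otimes>\<^sub>M E) (\<lambda>\<omega>. (?s \<omega>, \<omega> 0))) (C \<times> B) = \<dots>" .
qed

end

section \<open>Existence of disintegrations on standard Borel spaces\<close>

text \<open>Apply the hypothesis to the set where the inequality fails; finiteness allows the subtraction.\<close>
lemma AE_le_of_set_nn_integral_le:
  fixes u v :: "'a \<Rightarrow> ennreal"
  assumes u[measurable]: "u \<in> borel_measurable \<tau>" and v[measurable]: "v \<in> borel_measurable \<tau>"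
    and fin: "(\<integral>\<^sup>+y. v y \<partial>\<tau>) \<noteq> \<infinity>"
    and le: "\<And>A. A \<in> sets \<tau> \<Longrightarrow> (\<integral>\<^sup>+y\<in>A. u y \<partial>\<tau>) \<le> (\<integral>\<^sup>+y\<in>A. v y \<partial>\<tau>)"
  shows "AE y in \<tau>. u y \<le> v y"
proof -
  let ?A = "{y \<in> space \<tau>. v y < u y}"
  have A[measurable]: "?A \<in> sets \<tau>" by measurable
  have "(\<integral>\<^sup>+y\<in>?A. v y \<partial>\<tau>) \<le> (\<integral>\<^sup>+y. v y \<partial>\<tau>)"
    by (intro nn_integral_mono) (simp split: split_indicator)
  then have finA: "(\<integral>\<^sup>+y\<in>?A. v y \<partial>\<tau>) \<noteq> \<infinity>"
    using fin by (auto simp: top_unique)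
  have "(\<integral>\<^sup>+y. u y * indicator ?A y - v y * indicator ?A y \<partial>\<tau>) =
      (\<integral>\<^sup>+y\<in>?A. u y \<partial>\<tau>) - (\<integral>\<^sup>+y\<in>?A. v y \<partial>\<tau>)"
    using finA by (intro nn_integral_diff) (auto split: split_indicator)
  also have "\<dots> = 0"
    using le[OF A] le_less_trans[OF le[OF A], of \<infinity>] finA by (simp add: diff_eq_0_iff_ennreal top.not_eq_extremum)
  finally have "AE y in \<tau>. u y * indicator ?A y - v y * indicator ?A y = 0"
    by (subst (asm) nn_integral_0_iff_AE) auto
  with AE_space show ?thesis
    by eventually_elim (auto simp: diff_eq_0_iff_ennreal not_less split: split_indicator_asm)
qed

text \<open>The measure \<open>A \<mapsto> \<eta> (A \<times> B)\<close> is dominated by the marginal \<open>\<tau>\<close>, so it has a Radon--Nikodym density, the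
conditional probability of \<open>B\<close>.\<close>
lemma conditional_probability_density:
  assumes \<tau>: "prob_space \<tau>" and \<eta>: "prob_space \<eta>" and sets: "sets \<eta> = sets (\<tau> \<Otimes>\<^sub>M N)"
    and marg: "distr \<eta> \<tau> fst = \<tau>" and B: "B \<in> sets N"
  shows "\<exists>u\<in>borel_measurable \<tau>. \<forall>A\<in>sets \<tau>. emeasure \<eta> (A \<times> B) = (\<integral>\<^sup>+y\<in>A. u y \<partial>\<tau>)"
proof -
  interpret \<tau>: prob_space \<tau> by fact
  have sp: "space \<eta> = space \<tau> \<times> space N"
    using sets_eq_imp_space_eq[OF sets] by (simp add: space_pair_measure)
  have fst: "fst \<in> \<eta> \<rightarrow>\<^sub>M \<tau>"
    using measurable_fst by (simp add: measurable_cong_sets[OF sets refl])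
  have SB: "space \<tau> \<times> B \<in> sets \<eta>" using B by (simp add: sets)
  let ?N = "distr (density \<eta> (indicator (space \<tau> \<times> B))) \<tau> fst"
  have N: "emeasure ?N A = emeasure \<eta> (A \<times> B)" if A: "A \<in> sets \<tau>" for A
  proof -
    have AB: "A \<times> B \<in> sets \<eta>" using A B by (simp add: sets)
    have "emeasure ?N A = emeasure (density \<eta> (indicator (space \<tau> \<times> B))) (fst -` A \<inter> space \<eta>)"
      using fst A by (simp add: emeasure_distr)
    also have "\<dots> = (\<integral>\<^sup>+z. indicator (space \<tau> \<times> B) z * indicator (fst -` A \<inter> space \<eta>) z \<partial>\<eta>)"
      using SB measurable_sets[OF fst A] by (intro emeasure_density) auto
    also have "\<dots> = (\<integral>\<^sup>+z. indicator (A \<times> B) z \<partial>\<eta>)"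
      using sets.sets_into_space[OF A] by (intro nn_integral_cong) (auto simp: sp split: split_indicator)
    finally show ?thesis using AB by simp
  qed
  have "absolutely_continuous \<tau> ?N"
  proof (unfold absolutely_continuous_def, rule subsetI)
    fix A assume "A \<in> null_sets \<tau>"
    then have A: "A \<in> sets \<tau>" "emeasure \<tau> A = 0" by auto
    have "emeasure \<eta> (A \<times> B) \<le> emeasure \<eta> (fst -` A \<inter> space \<eta>)"
      using sets.sets_into_space[OF A(1)] sets.sets_into_space[OF B] measurable_sets[OF fst A(1)]
      by (intro emeasure_mono) (auto simp: sp)
    also have "\<dots> = emeasure (distr \<eta> \<tau> fst) A"
      using fst A by (simp add: emeasure_distr)
    also have "\<dots> = 0" by (simp add: marg A)
    finally show "A \<in> null_sets ?N" using A by (intro null_setsI) (simp_all add: N)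
  qed
  then obtain u where u: "u \<in> borel_measurable \<tau>" "density \<tau> u = ?N"
    using \<tau>.Radon_Nikodym[of ?N] by auto
  then have "emeasure \<eta> (A \<times> B) = (\<integral>\<^sup>+y\<in>A. u y \<partial>\<tau>)" if "A \<in> sets \<tau>" for A
    using emeasure_density[OF u(1) that] by (simp add: N that)
  with u(1) show ?thesis by blast
qed

text \<open>The densities \<open>u x\<close> of \<open>A \<mapsto> \<eta> (A \<times> {..x})\<close> should form a distribution function in \<open>x\<close>, but each is
fixed only up to a null set. The remedy is to keep countably many of them, at rational levels, and to
take the infimum over rational levels above \<open>x\<close>: this is monotone and continuous from the right for
every \<open>y\<close>, whatever the null sets. Concentration on \<open>[0, 1]\<close> makes it possible to prescribe
the values at rationals outside \<open>[0, 1)\<close>, which settles the limits at infinity as well.\<close>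
lemma disintegration_exists_real:
  assumes \<tau>: "prob_space \<tau>" and \<eta>: "prob_space \<eta>" and sets: "sets \<eta> = sets (\<tau> \<Otimes>\<^sub>M (borel :: real measure))"
    and marg: "distr \<eta> \<tau> fst = \<tau>"
    and supp: "emeasure \<eta> (space \<tau> \<times> {0..1}) = 1"
  shows "\<exists>\<kappa>. disintegration \<tau> borel \<eta> \<kappa>"
proof -
  interpret \<tau>: prob_space \<tau> by fact
  interpret \<eta>: prob_space \<eta> by fact
  have sp: "space \<eta> = space \<tau> \<times> UNIV"
    using sets_eq_imp_space_eq[OF sets] by (simp add: space_pair_measure)
  have fst: "fst \<in> \<eta> \<rightarrow>\<^sub>M \<tau>"
    using measurable_fst by (simp add: measurable_cong_sets[OF sets refl])
  have rect: "A \<times> B \<in> sets \<eta>" if "A \<in> sets \<tau>" "B \<in> sets borel" for A and B :: "real set"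
    using that by (simp add: sets)
  have cyl: "emeasure \<eta> (A \<times> UNIV) = emeasure \<tau> A" if A: "A \<in> sets \<tau>" for A
  proof -
    have "fst -` A \<inter> space \<eta> = A \<times> UNIV"
      using sets.sets_into_space[OF A] by (auto simp: sp)
    then have "emeasure (distr \<eta> \<tau> fst) A = emeasure \<eta> (A \<times> UNIV)"
      using fst A by (simp add: emeasure_distr)
    then show ?thesis by (simp add: marg)
  qed
  have "\<forall>x. \<exists>u\<in>borel_measurable \<tau>. \<forall>A\<in>sets \<tau>. emeasure \<eta> (A \<times> {..x::real}) = (\<integral>\<^sup>+y\<in>A. u y \<partial>\<tau>)"
    by (intro allI conditional_probability_density[OF \<tau> \<eta> sets marg]) simp
  then obtain u where u[measurable]: "\<And>x. u x \<in> borel_measurable \<tau>"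
    and u_int: "\<And>x A. A \<in> sets \<tau> \<Longrightarrow> emeasure \<eta> (A \<times> {..x::real}) = (\<integral>\<^sup>+y\<in>A. u x y \<partial>\<tau>)"
    by metis
  have u_mono: "AE y in \<tau>. u x y \<le> u x' y" if "x \<le> x'" for x x'
  proof (rule AE_le_of_set_nn_integral_le[OF u u])
    have "(\<integral>\<^sup>+y. u x' y \<partial>\<tau>) = (\<integral>\<^sup>+y\<in>space \<tau>. u x' y \<partial>\<tau>)"
      by (intro nn_integral_cong) simp
    also have "\<dots> = emeasure \<eta> (space \<tau> \<times> {..x'})"
      by (rule u_int[symmetric]) simp
    finally show "(\<integral>\<^sup>+y. u x' y \<partial>\<tau>) \<noteq> \<infinity>" by simp
    fix A assume "A \<in> sets \<tau>"
    with that show "(\<integral>\<^sup>+y\<in>A. u x y \<partial>\<tau>) \<le> (\<integral>\<^sup>+y\<in>A. u x' y \<partial>\<tau>)"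
      by (simp flip: u_int) (intro emeasure_mono rect, auto)
  qed
  have zero: "emeasure \<eta> (A \<times> {..x}) = 0" if "A \<in> sets \<tau>" "x < 0" for A x
  proof -
    have "emeasure \<eta> (A \<times> {..x}) \<le> emeasure \<eta> (space \<eta> - space \<tau> \<times> {0..1})"
      using that sets.sets_into_space[OF that(1)] by (intro emeasure_mono) (auto simp: sp rect)
    also have "\<dots> = 0"
      using supp by (subst emeasure_compl) (auto simp: rect \<eta>.emeasure_space_1)
    finally show ?thesis by simp
  qed
  have one: "emeasure \<eta> (A \<times> {..x}) = emeasure \<tau> A" if A: "A \<in> sets \<tau>" and "1 \<le> x" for A x
  proof -
    have ae: "AE z in \<eta>. z \<in> space \<tau> \<times> {0..1}"
      using supp rect[of "space \<tau>" "{0..1}"] by (intro \<eta>.AE_prob_1) (simp add: \<eta>.emeasure_eq_measure)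
    have "emeasure \<eta> (A \<times> {..x}) = emeasure \<eta> (A \<times> UNIV)"
    proof (rule emeasure_eq_AE)
      show "AE z in \<eta>. (z \<in> A \<times> {..x}) = (z \<in> A \<times> UNIV)"
        using ae by eventually_elim (use that in auto)
    qed (use rect A in auto)
    then show ?thesis using cyl[OF A] by simp
  qed
  define F where "F q y = (if q < 0 then 0 else if 1 \<le> q then 1 else enn2real (min 1 (u (of_rat q) y)))"
    for q :: rat and y
  have F[measurable]: "F q \<in> borel_measurable \<tau>" for q
    unfolding F_def[abs_def] by measurable
  have F01: "0 \<le> F q y" "F q y \<le> 1" for q y
    using enn2real_mono[of "min 1 (u (of_rat q) y)" 1] by (auto simp: F_def)
  have F_u: "AE y in \<tau>. ennreal (F q y) = u (of_rat q) y" for q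
  proof -
    have u0: "AE y in \<tau>. u (of_rat q) y = 0" if "q < 0"
    proof -
      have "AE y in \<tau>. u (of_rat q) y \<le> 0"
        using that by (intro AE_le_of_set_nn_integral_le) (auto simp: zero simp flip: u_int)
      then show ?thesis by simp
    qed
    have le1: "AE y in \<tau>. u (of_rat q) y \<le> 1"
    proof (rule AE_le_of_set_nn_integral_le)
      fix A assume A: "A \<in> sets \<tau>"
      have "emeasure \<eta> (A \<times> {..of_rat q}) \<le> emeasure \<eta> (A \<times> UNIV)"
        using A by (intro emeasure_mono rect) auto
      then show "(\<integral>\<^sup>+y\<in>A. u (of_rat q) y \<partial>\<tau>) \<le> (\<integral>\<^sup>+y\<in>A. 1 \<partial>\<tau>)"
        using A by (simp add: cyl flip: u_int)
    qed (auto simp: \<tau>.emeasure_space_1)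
    have u1: "AE y in \<tau>. 1 \<le> u (of_rat q) y" if "1 \<le> q"
    proof (rule AE_le_of_set_nn_integral_le)
      fix A assume A: "A \<in> sets \<tau>"
      then show "(\<integral>\<^sup>+y\<in>A. 1 \<partial>\<tau>) \<le> (\<integral>\<^sup>+y\<in>A. u (of_rat q) y \<partial>\<tau>)"
        using one[OF A, of "of_rat q"] that by (simp flip: u_int)
    next
      have "(\<integral>\<^sup>+y. u (of_rat q) y \<partial>\<tau>) = (\<integral>\<^sup>+y\<in>space \<tau>. u (of_rat q) y \<partial>\<tau>)"
        by (intro nn_integral_cong) simp
      also have "\<dots> = emeasure \<eta> (space \<tau> \<times> {..of_rat q})"
        by (rule u_int[symmetric]) simp
      finally show "(\<integral>\<^sup>+y. u (of_rat q) y \<partial>\<tau>) \<noteq> \<infinity>" by simp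
    qed auto
    consider "q < 0" | "1 \<le> q" | "0 \<le> q" "q < 1" by linarith
    then show ?thesis
    proof cases
      case 1
      with u0 show ?thesis by (simp add: F_def)
    next
      case 2
      have "AE y in \<tau>. u (of_rat q) y = 1"
        using u1[OF 2] le1 by eventually_elim (rule antisym)
      then show ?thesis by eventually_elim (use 2 in \<open>simp add: F_def\<close>)
    next
      case 3
      from le1 show ?thesis
        by eventually_elim (use 3 in \<open>auto simp: F_def min_def le_less_trans\<close>)
    qed
  qed
  define G where "G y x = (INF q\<in>{q. x < of_rat q}. F q y)" for x :: real and y
  have ne: "{q. x < real_of_rat q} \<noteq> {}" for x
    using of_rat_dense[of x "x + 1"] by auto
  have bdd: "bdd_below ((\<lambda>q. F q y) ` X)" for X y
    by (rule bdd_belowI2[of _ 0]) (rule F01)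
  have G_le: "G y x \<le> F q y" if "x < of_rat q" for x y q
    unfolding G_def by (rule cINF_lower[OF bdd]) (use that in simp)
  have G_ge: "c \<le> G y x" if "\<And>q. x < of_rat q \<Longrightarrow> c \<le> F q y" for x y c
    unfolding G_def by (rule cINF_greatest[OF ne]) (use that in simp)
  have G0: "0 \<le> G y x" for x y
    by (rule G_ge) (rule F01)
  have G1: "G y x \<le> 1" for x y
  proof -
    obtain q where "q \<in> {q. x < real_of_rat q}" using ne by blast
    then show ?thesis using G_le[of x q y] F01(2)[of q y] by simp
  qed
  have G_mono: "G y x \<le> G y x'" if "x \<le> x'" for x x' y
    by (rule G_ge) (use that in \<open>auto intro: G_le\<close>)
  have G_right: "continuous (at_right x) (G y)" for x y
    unfolding continuous_within
  proof (rule tendstoI)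
    fix e :: real assume e: "0 < e"
    have "\<exists>q\<in>{q. x < real_of_rat q}. F q y < G y x + e"
      using e unfolding cINF_less_iff[OF ne bdd, symmetric] by (simp add: G_def)
    then obtain q where q: "x < real_of_rat q" "F q y < G y x + e" by auto
    have "dist (G y z) (G y x) < e" if "x < z" "z < of_rat q" for z
      using G_mono[of x z y] G_le[OF that(2), of y] q(2) that(1) by (simp add: dist_real_def)
    then show "\<forall>\<^sub>F z in at_right x. dist (G y z) (G y x) < e"
      using q(1) eventually_at_right by (auto simp: eventually_at_right_field)
  qed
  have G_bot: "G y x = 0" if neg: "x < 0" for x y
  proof -
    obtain q where q: "x < real_of_rat q" "of_rat q < (0::real)"
      using of_rat_dense[OF neg] by auto
    then have "F q y = 0" by (simp add: F_def)
    with G_le[OF q(1), of y] G0[of y x] show ?thesis by simp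
  qed
  have G_top: "G y x = 1" if "1 \<le> x" for x y
  proof (rule antisym[OF G1], rule G_ge)
    fix q assume "x < real_of_rat q"
    with that have "1 < real_of_rat q" by (rule le_less_trans)
    then show "1 \<le> F q y" by (simp add: F_def)
  qed
  have lim_bot: "(G y \<longlongrightarrow> 0) at_bot" for y
    by (rule tendsto_eventually[OF eventually_mono[OF eventually_gt_at_bot[of 0]]]) (rule G_bot)
  have lim_top: "(G y \<longlongrightarrow> 1) at_top" for y
    by (rule tendsto_eventually[OF eventually_mono[OF eventually_ge_at_top[of 1]]]) (rule G_top)
  have G_meas[measurable]: "(\<lambda>y. G y x) \<in> borel_measurable \<tau>" for x
    unfolding G_def by (rule borel_measurable_cINF) (auto simp: bdd)
  \<comment> \<open>Almost surely \<open>u x\<close> is below \<open>u q\<close> for all rational \<open>q > x\<close> at once, hence below the infimum. The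
    opposite inequality is proved after integration, by continuity of \<open>\<eta>\<close> from above.\<close>
  have G_u: "AE y in \<tau>. u x y \<le> ennreal (G y x)" for x
  proof -
    have "AE y in \<tau>. \<forall>q\<in>{q. x < real_of_rat q}. u x y \<le> ennreal (F q y)"
    proof (rule AE_ball_countable')
      fix q assume "q \<in> {q. x < real_of_rat q}"
      then have "x \<le> real_of_rat q" by simp
      from u_mono[OF this] F_u[of q] show "AE y in \<tau>. u x y \<le> ennreal (F q y)"
        by eventually_elim simp
    qed (rule countableI_type)
    then show ?thesis
    proof eventually_elim
      case (elim y)
      have fin: "u x y < top"
      proof -
        obtain q where "q \<in> {q. x < real_of_rat q}" using ne by blast
        with elim have "u x y \<le> ennreal (F q y)" by blast
        then show ?thesis by (rule le_less_trans) simp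
      qed
      have "enn2real (u x y) \<le> G y x"
      proof (rule G_ge)
        fix q assume "x < real_of_rat q"
        with elim have "enn2real (u x y) \<le> enn2real (ennreal (F q y))"
          by (intro enn2real_mono) auto
        then show "enn2real (u x y) \<le> F q y" by (simp add: F01)
      qed
      then have "ennreal (enn2real (u x y)) \<le> ennreal (G y x)" by (rule ennreal_leI)
      then show ?case using fin by simp
    qed
  qed
  have G_int: "emeasure \<eta> (A \<times> {..x}) = (\<integral>\<^sup>+y\<in>A. G y x \<partial>\<tau>)" if A: "A \<in> sets \<tau>" for A x
  proof (rule antisym)
    have "(\<integral>\<^sup>+y\<in>A. u x y \<partial>\<tau>) \<le> (\<integral>\<^sup>+y\<in>A. G y x \<partial>\<tau>)"
      by (rule nn_integral_mono_AE, rule eventually_mono[OF G_u[of x]]) (auto split: split_indicator)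
    then show "emeasure \<eta> (A \<times> {..x}) \<le> (\<integral>\<^sup>+y\<in>A. G y x \<partial>\<tau>)"
      using A by (simp add: u_int)
  next
    have "\<exists>q. x < of_rat q \<and> of_rat q < x + inverse (Suc n)" for n
      using of_rat_dense[of x "x + inverse (Suc n)"] by auto
    then obtain q where q: "\<And>n. x < of_rat (q n)" "\<And>n. of_rat (q n) < x + inverse (Suc n)"
      by metis
    have "(\<integral>\<^sup>+y\<in>A. G y x \<partial>\<tau>) \<le> emeasure \<eta> (A \<times> {..x + inverse (Suc n)})" for n
    proof -
      have "(\<integral>\<^sup>+y\<in>A. G y x \<partial>\<tau>) \<le> (\<integral>\<^sup>+y\<in>A. u (of_rat (q n)) y \<partial>\<tau>)"
      proof (rule nn_integral_mono_AE)
        show "AE y in \<tau>. ennreal (G y x) * indicator A y \<le> u (of_rat (q n)) y * indicator A y"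
          using F_u[of "q n"]
        proof eventually_elim
          case (elim y)
          show ?case unfolding elim[symmetric]
            by (intro mult_right_mono ennreal_leI G_le q) simp
        qed
      qed
      also have "\<dots> = emeasure \<eta> (A \<times> {..of_rat (q n)})" using A by (simp add: u_int)
      also have "\<dots> \<le> emeasure \<eta> (A \<times> {..x + inverse (Suc n)})"
        using A q(2)[of n] by (intro emeasure_mono rect) auto
      finally show ?thesis .
    qed
    moreover have "(\<lambda>n. emeasure \<eta> (A \<times> {..x + inverse (Suc n)})) \<longlonglongrightarrow> emeasure \<eta> (\<Inter>n. A \<times> {..x + inverse (Suc n)})"
    proof (rule Lim_emeasure_decseq)
      show "decseq (\<lambda>n. A \<times> {..x + inverse (real (Suc n))})"
      proof (rule antimonoI)
        fix k l :: nat assume "k \<le> l"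
        then have "inverse (real (Suc l)) \<le> inverse (real (Suc k))"
          by (intro le_imp_inverse_le) auto
        then show "A \<times> {..x + inverse (real (Suc l))} \<subseteq> A \<times> {..x + inverse (real (Suc k))}"
          by (intro Sigma_mono order_refl) (simp only: atMost_subset_iff add_le_cancel_left)
      qed
    qed (auto simp: rect A)
    moreover have "(\<Inter>n. A \<times> {..x + inverse (real (Suc n))}) = A \<times> {..x}"
    proof (intro antisym subsetI)
      fix z assume z: "z \<in> (\<Inter>n. A \<times> {..x + inverse (real (Suc n))})"
      have "snd z \<le> x + e" if "0 < e" for e
      proof -
        from reals_Archimedean[OF that] obtain n where "inverse (real (Suc n)) < e" by blast
        moreover have "snd z \<le> x + inverse (real (Suc n))"
          using z by (cases z) auto
        ultimately show ?thesis by linarith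
      qed
      then have "snd z \<le> x" by (rule field_le_epsilon)
      with z show "z \<in> A \<times> {..x}" by (cases z) auto
    next
      fix z assume "z \<in> A \<times> {..x}"
      moreover have "0 \<le> inverse (real (Suc n))" for n by simp
      ultimately show "z \<in> (\<Inter>n. A \<times> {..x + inverse (real (Suc n))})"
        by (cases z) (force intro: add_increasing2)
    qed
    ultimately show "(\<integral>\<^sup>+y\<in>A. G y x \<partial>\<tau>) \<le> emeasure \<eta> (A \<times> {..x})"
      by (intro LIMSEQ_le_const) auto
  qed
  define \<kappa> where "\<kappa> y = interval_measure (G y)" for y
  have \<kappa>_prob: "real_distribution (\<kappa> y)" for y
    unfolding \<kappa>_def by (rule real_distribution_interval_measure[OF G_mono G_right lim_bot lim_top])
  have \<kappa>_Iic: "emeasure (\<kappa> y) {..x} = ennreal (G y x)" for y x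
    unfolding \<kappa>_def by (rule emeasure_interval_measure_Iic[OF G_mono G_right lim_bot])
  have gen: "sets (borel :: real measure) = sigma_sets UNIV (range atMost)"
    by (simp add: borel_eq_atMost)
  have stable: "Int_stable (range (atMost :: real \<Rightarrow> real set))"
    by (auto simp: Int_stable_def)
  have \<kappa>[measurable]: "\<kappa> \<in> \<tau> \<rightarrow>\<^sub>M prob_algebra borel"
  proof (rule measurable_prob_algebra_generated[OF gen stable])
    show "prob_space (\<kappa> y)" for y using \<kappa>_prob by (simp add: real_distribution_def)
    show "sets (\<kappa> y) = sets borel" for y by (simp add: \<kappa>_def)
    fix B assume "B \<in> range (atMost :: real \<Rightarrow> real set)"
    then show "(\<lambda>y. emeasure (\<kappa> y) B) \<in> borel_measurable \<tau>" by (auto simp: \<kappa>_Iic)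
  qed simp
  obtain \<eta>' where \<eta>': "disintegration \<tau> borel \<eta>' \<kappa>"
    using disintegration_bind[OF \<tau> \<kappa>] by blast
  have "emeasure \<eta> (A \<times> B) = emeasure \<eta>' (A \<times> B)" if A: "A \<in> sets \<tau>" and B: "B \<in> sets borel" for A B
  proof -
    \<comment> \<open>For fixed \<open>A\<close>, both sides are finite measures in \<open>B\<close> that agree on the half-lines.\<close>
    let ?N = "\<lambda>\<eta>. distr (density \<eta> (indicator (A \<times> UNIV))) borel snd :: real measure"
    have N: "emeasure (?N \<zeta>) B = emeasure \<zeta> (A \<times> B)"
      if s: "sets \<zeta> = sets (\<tau> \<Otimes>\<^sub>M borel)" and B: "B \<in> sets borel" for \<zeta> B
    proof -
      have sp: "space \<zeta> = space \<tau> \<times> UNIV"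
        using sets_eq_imp_space_eq[OF s] by (simp add: space_pair_measure)
      have snd: "snd \<in> \<zeta> \<rightarrow>\<^sub>M borel"
        using measurable_snd by (simp add: measurable_cong_sets[OF s refl])
      have AB: "A \<times> B \<in> sets \<zeta>" "A \<times> UNIV \<in> sets \<zeta>" using A B by (simp_all add: s)
      have "emeasure (?N \<zeta>) B = emeasure (density \<zeta> (indicator (A \<times> UNIV))) (snd -` B \<inter> space \<zeta>)"
        using snd B by (simp add: emeasure_distr)
      also have "\<dots> = (\<integral>\<^sup>+z. indicator (A \<times> UNIV) z * indicator (snd -` B \<inter> space \<zeta>) z \<partial>\<zeta>)"
        using AB measurable_sets[OF snd B] by (intro emeasure_density) auto
      also have "\<dots> = (\<integral>\<^sup>+z. indicator (A \<times> B) z \<partial>\<zeta>)"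
        using sets.sets_into_space[OF A] by (intro nn_integral_cong) (auto simp: sp split: split_indicator)
      finally show ?thesis using AB by simp
    qed
    have s': "sets \<eta>' = sets (\<tau> \<Otimes>\<^sub>M borel)" by (rule disintegrationD(2)[OF \<eta>'])
    have "?N \<eta> = ?N \<eta>'"
    proof (rule measure_eqI_generator_eq[OF stable, where \<Omega> = UNIV and A = "\<lambda>n. {..real n}"])
      show "emeasure (?N \<eta>) X = emeasure (?N \<eta>') X" if "X \<in> range atMost" for X
        using that A by (auto simp: N[OF sets] N[OF s'] G_int \<kappa>_Iic disintegrationD(6)[OF \<eta>'])
      show "(\<Union>i. {..real i}) = UNIV"
        using real_arch_simple by auto
      show "emeasure (?N \<eta>) {..real i} \<noteq> \<infinity>" for i
        by (simp add: N[OF sets])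
    qed (simp_all add: gen image_subset_iff)
    then have "emeasure (?N \<eta>) B = emeasure (?N \<eta>') B" by simp
    with B show ?thesis by (simp add: N[OF sets] N[OF s'])
  qed
  then have "disintegration \<tau> borel \<eta> \<kappa>"
    by (intro disintegrationI[OF \<tau> sets \<kappa>]) (simp add: disintegrationD(6)[OF \<eta>'])
  then show ?thesis by blast
qed

text \<open>Base \<open>3\<close> with digits \<open>0\<close> and \<open>1\<close> only, as in a Cantor set: the tail after a digit is
at most half a unit of that digit, so that the digits can be read off from the number.\<close>
definition ternary_code :: "(nat \<Rightarrow> bool) \<Rightarrow> real" where
  "ternary_code b = (\<Sum>n. of_bool (b n) / 3 ^ Suc n)"

text \<open>On codes, this drops the first digit.\<close>
definition ternary_shift :: "real \<Rightarrow> real" where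
  "ternary_shift r = 3 * r - of_bool (1 / 3 \<le> r)"

definition ternary_digit :: "nat \<Rightarrow> real \<Rightarrow> bool" where
  "ternary_digit n r \<longleftrightarrow> 1 / 3 \<le> (ternary_shift ^^ n) r"

lemma summable_ternary: "summable (\<lambda>n. of_bool (b n) / 3 ^ Suc n :: real)"
  and ternary_code_bounds: "0 \<le> ternary_code b" "ternary_code b \<le> 1 / 2"
proof -
  have g: "(\<lambda>n. 1 / 3 * (1 / 3) ^ n :: real) sums (1 / 3 * (1 / (1 - 1 / 3)))"
    by (intro sums_mult geometric_sums) simp
  have le: "of_bool (b n) / 3 ^ Suc n \<le> (1 / 3 * (1 / 3) ^ n :: real)" for n
    by (simp add: power_divide divide_right_mono)
  show s: "summable (\<lambda>n. of_bool (b n) / 3 ^ Suc n :: real)"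
    by (rule summable_comparison_test'[OF sums_summable[OF g], of 0]) (use le in simp)
  show "0 \<le> ternary_code b"
    unfolding ternary_code_def by (rule suminf_nonneg[OF s]) simp
  have "ternary_code b \<le> (\<Sum>n. 1 / 3 * (1 / 3) ^ n)"
    unfolding ternary_code_def by (rule suminf_le[OF le s sums_summable[OF g]])
  also have "\<dots> = 1 / 2" using sums_unique[OF g] by simp
  finally show "ternary_code b \<le> 1 / 2" .
qed

lemma ternary_code_step: "ternary_code b = (of_bool (b 0) + ternary_code (\<lambda>n. b (Suc n))) / 3"
proof -
  have "ternary_code b = of_bool (b 0) / 3 + (\<Sum>n. of_bool (b (Suc n)) / 3 ^ Suc (Suc n))"
    unfolding ternary_code_def using suminf_split_head[OF summable_ternary[of b]] by simp
  also have "(\<Sum>n. of_bool (b (Suc n)) / 3 ^ Suc (Suc n)) = (\<Sum>n. of_bool (b (Suc n)) / 3 ^ Suc n / 3 :: real)"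
    by (simp add: mult.commute)
  also have "\<dots> = ternary_code (\<lambda>n. b (Suc n)) / 3"
    unfolding ternary_code_def by (rule suminf_divide[OF summable_ternary])
  finally show ?thesis by (simp add: add_divide_distrib)
qed

lemma ternary_digit_code: "ternary_digit n (ternary_code b) = b n"
proof (induction n arbitrary: b)
  case 0
  show ?case
    using ternary_code_step[of b] ternary_code_bounds[of "\<lambda>n. b (Suc n)"]
    by (cases "b 0") (simp_all add: ternary_digit_def)
next
  case (Suc n)
  have "ternary_shift (ternary_code b) = ternary_code (\<lambda>n. b (Suc n))"
    using ternary_code_step[of b] ternary_code_bounds[of "\<lambda>n. b (Suc n)"]
    by (cases "b 0") (simp_all add: ternary_shift_def)
  with Suc show ?case by (simp add: ternary_digit_def funpow_Suc_right del: funpow.simps)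
qed

lemma measurable_ternary_digit: "Measurable.pred borel (ternary_digit n)"
proof -
  have "ternary_shift \<in> borel_measurable borel"
    unfolding ternary_shift_def[abs_def] by measurable
  then have [measurable]: "(ternary_shift ^^ n) \<in> borel_measurable borel"
    by (rule measurable_compose_n)
  show ?thesis unfolding ternary_digit_def[abs_def] by measurable
qed

text \<open>A point \<open>x\<close> of a Polish space is determined by the table that records, for every \<open>k\<close> and every member
\<open>c i\<close> of a countable dense set, whether \<open>c i\<close> is closer than \<open>1 / (k + 1)\<close> to \<open>x\<close>. The map \<open>\<phi>\<close> codes the
table as a real number. To decode, \<open>\<psi>\<close> reads off the first index \<open>i\<close> that the table admits for each
\<open>k\<close>, and takes the limit of the resulting sequence in the dense set. By completeness
this works for every real number whose decoded sequence is Cauchy, a measurable condition, so that \<open>\<psi>\<close>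
extends measurably to the whole line; the image of \<open>\<phi>\<close> never has to be identified.\<close>
lemma standard_borel_retract_of_unit_interval:
  assumes M: "standard_borel M" and ne: "space M \<noteq> {}"
  obtains \<phi> :: "'x \<Rightarrow> real" and \<psi> where "\<phi> \<in> M \<rightarrow>\<^sub>M borel" "\<psi> \<in> borel \<rightarrow>\<^sub>M M"
    "\<And>x. x \<in> space M \<Longrightarrow> \<phi> x \<in> {0..1}" "\<And>x. x \<in> space M \<Longrightarrow> \<psi> (\<phi> x) = x"
proof -
  from M obtain T where T: "topspace T = space M" "completely_metrizable_space T" "second_countable T"
    and sets_M: "sets M = sigma_sets (topspace T) {U. openin T U}"
    by (auto simp: standard_borel_def)
  from T(2) obtain X d where "Metric_space X d" and complete: "Metric_space.mcomplete X d"
    and top: "T = Metric_space.mtopology X d"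
    by (auto simp: completely_metrizable_space_def)
  interpret Metric_space X d by fact
  have X: "X = space M" using T(1) by (simp add: top)
  obtain C where C: "countable C" "C \<subseteq> X" "mtopology closure_of C = X"
    using second_countable_imp_separable_space[OF T(3)] by (auto simp: separable_space_def top)
  then have "C \<noteq> {}" using ne X by auto
  define c where "c = from_nat_into C"
  have c_X: "c i \<in> X" for i
    using from_nat_into[OF \<open>C \<noteq> {}\<close>] C(2) by (auto simp: c_def)
  have dense: "\<exists>i. d (c i) x < e" if x: "x \<in> X" and "0 < e" for x e
  proof -
    have "x \<in> mtopology closure_of C" using C(3) x by simp
    then obtain y where y: "y \<in> C" "y \<in> mball x e"
      using \<open>0 < e\<close> by (auto simp: metric_closure_of)
    obtain i where "c i = y"
      using from_nat_into_surj[OF C(1) y(1)] by (auto simp: c_def)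
    with y(2) show ?thesis by (auto simp: commute)
  qed
  have open_M: "U \<in> sets M" if "openin mtopology U" for U
    unfolding sets_M using that by (intro sigma_sets.Basic) (simp add: top)
  have ball_M: "{x \<in> space M. d (c i) x < e} \<in> sets M" for i e
  proof -
    have "{x \<in> space M. d (c i) x < e} = mball (c i) e"
      using c_X[of i] by (auto simp flip: X)
    then show ?thesis using open_M[OF openin_mball] by simp
  qed
  define near where "near x n = (case prod_decode n of (k, i) \<Rightarrow> d (c i) x < inverse (real (Suc k)))" for x n
  define \<phi> where "\<phi> x = ternary_code (near x)" for x
  define idx where "idx k r = (LEAST i. ternary_digit (prod_encode (k, i)) r)" for k r
  define s where "s r k = c (idx k r)" for r k
  define \<psi> where "\<psi> r = (if MCauchy (s r) then SOME l. limitin mtopology (s r) l sequentially else c 0)" for r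
  have s_X: "s r k \<in> X" for r k by (simp add: s_def c_X)
  have \<phi>: "\<phi> \<in> M \<rightarrow>\<^sub>M borel"
  proof -
    have "Measurable.pred M (\<lambda>x. near x n)" for n
      using ball_M by (cases "prod_decode n") (simp add: near_def pred_def)
    then have [measurable]: "\<And>n. Measurable.pred M (\<lambda>x. near x n)" .
    show ?thesis unfolding \<phi>_def[abs_def] ternary_code_def by measurable
  qed
  have idx: "idx k \<in> borel \<rightarrow>\<^sub>M count_space UNIV" for k
    unfolding idx_def[abs_def] by (intro measurable_Least measurable_ternary_digit)
  have discrete2: "(\<lambda>r. h (idx k r) (idx l r)) \<in> borel_measurable borel" for h :: "nat \<Rightarrow> nat \<Rightarrow> real" and k l
    by (rule measurable_compose_countable[OF _ idx[of k]], rule measurable_compose[OF idx[of l]]) simp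
  have d_s[measurable]: "(\<lambda>r. d (s r k) (s r l)) \<in> borel_measurable borel"
    "(\<lambda>r. d (c i) (s r k)) \<in> borel_measurable borel" for k l i
    unfolding s_def by (rule discrete2)+
  have Cauchy_iff: "MCauchy (s r) \<longleftrightarrow> (\<forall>j. \<exists>N. \<forall>n. \<forall>n'. N \<le> n \<longrightarrow> N \<le> n' \<longrightarrow> d (s r n) (s r n') < inverse (real (Suc j)))" for r
  proof
    assume "MCauchy (s r)"
    then show "\<forall>j. \<exists>N. \<forall>n. \<forall>n'. N \<le> n \<longrightarrow> N \<le> n' \<longrightarrow> d (s r n) (s r n') < inverse (real (Suc j))"
      unfolding MCauchy_def by simp
  next
    assume *: "\<forall>j. \<exists>N. \<forall>n. \<forall>n'. N \<le> n \<longrightarrow> N \<le> n' \<longrightarrow> d (s r n) (s r n') < inverse (real (Suc j))"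
    show "MCauchy (s r)"
      unfolding MCauchy_def
    proof (intro conjI allI impI)
      fix e :: real assume "0 < e"
      from reals_Archimedean[OF this] obtain j where j: "inverse (real (Suc j)) < e" by blast
      from * obtain N where "\<forall>n. \<forall>n'. N \<le> n \<longrightarrow> N \<le> n' \<longrightarrow> d (s r n) (s r n') < inverse (real (Suc j))" by blast
      with j show "\<exists>N. \<forall>n n'. N \<le> n \<longrightarrow> N \<le> n' \<longrightarrow> d (s r n) (s r n') < e"
        by (meson less_trans)
    qed (auto simp: s_X)
  qed
  have Cauchy_meas[measurable]: "Measurable.pred borel (\<lambda>r. MCauchy (s r))"
    unfolding Cauchy_iff by measurable
  have lim_\<psi>: "limitin mtopology (s r) (\<psi> r) sequentially" if "MCauchy (s r)" for r
    using complete that unfolding mcomplete_def \<psi>_def by (auto intro: someI_ex)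
  have \<psi>_X: "\<psi> r \<in> X" for r
    using lim_\<psi>[of r] c_X by (cases "MCauchy (s r)") (auto simp: limitin_metric \<psi>_def)
  \<comment> \<open>The distance to a fixed point turns the limit in \<open>M\<close> into a limit of real functions. Open sets are
    countable unions of balls around the \<open>c i\<close>, so these distances decide the measurability of \<open>\<psi>\<close>.\<close>
  have d_\<psi>: "(\<lambda>r. d (c i) (\<psi> r)) \<in> borel_measurable borel" for i
  proof -
    have "d (c i) (\<psi> r) = (if MCauchy (s r) then lim (\<lambda>k. d (c i) (s r k)) else d (c i) (c 0))" for r
    proof (cases "MCauchy (s r)")
      case True
      have "(\<lambda>k. d (c i) (s r k) - d (c i) (\<psi> r)) \<longlonglongrightarrow> 0"
      proof (rule Lim_null_comparison)
        show "(\<lambda>k. d (s r k) (\<psi> r)) \<longlonglongrightarrow> 0"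
          using lim_\<psi>[OF True] by (simp add: limitin_metric_dist_null)
        have "norm (d (c i) (s r k) - d (c i) (\<psi> r)) \<le> d (s r k) (\<psi> r)" for k
          using triangle[OF c_X[of i] \<psi>_X[of r] s_X[of r k]] triangle[OF c_X[of i] s_X[of r k] \<psi>_X[of r]]
          by (simp add: commute abs_le_iff)
        then show "\<forall>\<^sub>F k in sequentially. norm (d (c i) (s r k) - d (c i) (\<psi> r)) \<le> d (s r k) (\<psi> r)"
          by (intro always_eventually allI)
      qed
      then have "(\<lambda>k. d (c i) (s r k)) \<longlonglongrightarrow> d (c i) (\<psi> r)"
        by (rule LIM_zero_cancel)
      then show ?thesis using True by (simp add: limI)
    qed (simp add: \<psi>_def)
    then show ?thesis by simp
  qed
  have \<psi>: "\<psi> \<in> borel \<rightarrow>\<^sub>M M"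
  proof (rule measurable_sigma_sets[OF sets_M])
    show "{U. openin T U} \<subseteq> Pow (topspace T)" by (auto dest: openin_subset)
    show "\<psi> \<in> space borel \<rightarrow> topspace T" using \<psi>_X by (simp add: top)
    fix U assume "U \<in> {U. openin T U}"
    then have U: "openin mtopology U" by (simp add: top)
    define I where "I = {(i, n). mball (c i) (inverse (real (Suc n))) \<subseteq> U}"
    have "x \<in> U \<longleftrightarrow> (\<exists>(i, n)\<in>I. d (c i) x < inverse (real (Suc n)))" if x: "x \<in> X" for x
    proof
      assume "x \<in> U"
      then obtain e where e: "0 < e" "mball x e \<subseteq> U"
        using U by (auto simp: openin_mtopology)
      obtain n where n: "inverse (real (Suc n)) < e / 2"
        using reals_Archimedean[of "e / 2"] e(1) by auto
      obtain i where i: "d (c i) x < inverse (real (Suc n))"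
        using dense[OF x, of "inverse (real (Suc n))"] by auto
      have "mball (c i) (inverse (real (Suc n))) \<subseteq> mball x e"
      proof
        fix y assume "y \<in> mball (c i) (inverse (real (Suc n)))"
        then have y: "y \<in> X" "d (c i) y < inverse (real (Suc n))" by auto
        have "d x y \<le> d (c i) x + d (c i) y"
          using triangle[OF x c_X y(1), of i] by (simp add: commute)
        with i y n show "y \<in> mball x e" by (simp add: x)
      qed
      with e(2) i show "\<exists>(i, n)\<in>I. d (c i) x < inverse (real (Suc n))"
        by (auto simp: I_def)
    next
      assume "\<exists>(i, n)\<in>I. d (c i) x < inverse (real (Suc n))"
      then show "x \<in> U" using x c_X by (auto simp: I_def)
    qed
    then have "\<psi> -` U \<inter> space borel = (\<Union>(i, n)\<in>I. {r \<in> space borel. d (c i) (\<psi> r) < inverse (real (Suc n))})"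
      using \<psi>_X by auto
    also have "\<dots> \<in> sets borel"
    proof (intro sets.countable_UN'')
      show "(case z of (i, n) \<Rightarrow> {r \<in> space borel. d (c i) (\<psi> r) < inverse (real (Suc n))}) \<in> sets borel" for z
        by (cases z) (simp only: case_prod_conv borel_measurable_less d_\<psi> borel_measurable_const)
    qed simp
    finally show "\<psi> -` U \<inter> space borel \<in> sets borel" .
  qed
  have "\<psi> (\<phi> x) = x" if x: "x \<in> space M" for x
  proof -
    have xX: "x \<in> X" using x by (simp add: X)
    have digit: "ternary_digit (prod_encode (k, i)) (\<phi> x) \<longleftrightarrow> d (c i) x < inverse (real (Suc k))" for k i
      by (simp add: \<phi>_def ternary_digit_code near_def)
    have near: "d (s (\<phi> x) k) x < inverse (real (Suc k))" for k
    proof -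
      obtain i where "d (c i) x < inverse (real (Suc k))"
        using dense[OF xX, of "inverse (real (Suc k))"] by auto
      then have "ternary_digit (prod_encode (k, i)) (\<phi> x)" by (simp only: digit)
      then have "ternary_digit (prod_encode (k, idx k (\<phi> x))) (\<phi> x)"
        unfolding idx_def by (rule LeastI)
      then show ?thesis by (simp only: digit s_def)
    qed
    have "(\<lambda>k. d (s (\<phi> x) k) x) \<longlonglongrightarrow> 0"
      by (rule tendsto_sandwich[OF _ _ tendsto_const LIMSEQ_inverse_real_of_nat])
         (use near in \<open>auto intro!: always_eventually less_imp_le\<close>)
    then have lim: "limitin mtopology (s (\<phi> x)) x sequentially"
      by (simp add: limitin_metric_dist_null xX s_X)
    have "MCauchy (s (\<phi> x))"
      using convergent_imp_MCauchy[OF _ lim] s_X by auto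
    from limitin_metric_unique[OF lim_\<psi>[OF this] lim] show ?thesis by simp
  qed
  moreover have "\<phi> x \<in> {0..1}" for x
    using ternary_code_bounds[of "near x"] by (simp add: \<phi>_def)
  ultimately show thesis using that \<phi> \<psi> by blast
qed

text \<open>Code the second factor in the unit interval, disintegrate there, and decode the kernel. As
\<open>\<psi>\<close> is defined and measurable on the whole line, the decoded kernel is a kernel on \<open>M\<close> at every point.\<close>
lemma disintegration_exists:
  fixes \<tau> :: "'y measure" and M :: "'x measure"
  assumes M: "standard_borel M" and \<eta>: "prob_space \<eta>" and sets: "sets \<eta> = sets (\<tau> \<Otimes>\<^sub>M M)"
    and marg: "distr \<eta> \<tau> fst = \<tau>"
  shows "\<exists>\<kappa>. disintegration \<tau> M \<eta> \<kappa>"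
proof -
  interpret \<eta>: prob_space \<eta> by fact
  have fst: "fst \<in> \<eta> \<rightarrow>\<^sub>M \<tau>" and snd: "snd \<in> \<eta> \<rightarrow>\<^sub>M M"
    using measurable_fst measurable_snd by (simp_all add: measurable_cong_sets[OF sets refl])
  have \<tau>: "prob_space \<tau>" using \<eta>.prob_space_distr[OF fst] by (simp add: marg)
  have "space M \<noteq> {}"
    using \<eta>.not_empty measurable_space[OF snd] by auto
  from standard_borel_retract_of_unit_interval[OF M this] obtain \<phi> :: "'x \<Rightarrow> real" and \<psi>
    where \<phi>: "\<phi> \<in> M \<rightarrow>\<^sub>M borel" and \<psi>: "\<psi> \<in> borel \<rightarrow>\<^sub>M M"
    and \<phi>01: "\<And>x. x \<in> space M \<Longrightarrow> \<phi> x \<in> {0..1}" and inv: "\<And>x. x \<in> space M \<Longrightarrow> \<psi> (\<phi> x) = x"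
    by metis
  define \<eta>' where "\<eta>' = distr \<eta> (\<tau> \<Otimes>\<^sub>M borel) (\<lambda>z. (fst z, \<phi> (snd z)))"
  have g: "(\<lambda>z. (fst z, \<phi> (snd z))) \<in> \<eta> \<rightarrow>\<^sub>M \<tau> \<Otimes>\<^sub>M borel"
    by (intro measurable_Pair fst measurable_compose[OF snd \<phi>])
  have sp: "z \<in> space \<eta> \<Longrightarrow> fst z \<in> space \<tau> \<and> snd z \<in> space M" for z
    using measurable_space[OF fst] measurable_space[OF snd] by auto
  have "\<exists>\<kappa>. disintegration \<tau> borel \<eta>' \<kappa>"
  proof (rule disintegration_exists_real[OF \<tau>])
    show "prob_space \<eta>'" unfolding \<eta>'_def by (rule \<eta>.prob_space_distr[OF g])
    show "sets \<eta>' = sets (\<tau> \<Otimes>\<^sub>M borel)" by (simp add: \<eta>'_def)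
    have "distr \<eta>' \<tau> fst = distr \<eta> \<tau> fst"
      unfolding \<eta>'_def by (subst distr_distr[OF _ g]) (simp_all add: comp_def)
    then show "distr \<eta>' \<tau> fst = \<tau>" by (simp add: marg)
    have "emeasure \<eta>' (space \<tau> \<times> {0..1}) = emeasure \<eta> ((\<lambda>z. (fst z, \<phi> (snd z))) -` (space \<tau> \<times> {0..1}) \<inter> space \<eta>)"
      unfolding \<eta>'_def by (rule emeasure_distr[OF g]) simp
    also have "(\<lambda>z. (fst z, \<phi> (snd z))) -` (space \<tau> \<times> {0..1}) \<inter> space \<eta> = space \<eta>"
      using sp \<phi>01 by auto
    finally show "emeasure \<eta>' (space \<tau> \<times> {0..1}) = 1" by (simp add: \<eta>.emeasure_space_1)
  qed
  then obtain \<kappa> where \<kappa>: "disintegration \<tau> borel \<eta>' \<kappa>" by blast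
  note \<kappa>m = disintegrationD(5)[OF \<kappa>]
  have "disintegration \<tau> M \<eta> (\<lambda>y. distr (\<kappa> y) M \<psi>)"
  proof (rule disintegrationI[OF \<tau> sets])
    show "(\<lambda>y. distr (\<kappa> y) M \<psi>) \<in> \<tau> \<rightarrow>\<^sub>M prob_algebra M"
      by (rule measurable_compose[OF \<kappa>m measurable_distr_prob_space[OF \<psi>]])
    fix A B assume A: "A \<in> sets \<tau>" and B: "B \<in> sets M"
    have B': "\<psi> -` B \<in> sets borel" using measurable_sets[OF \<psi> B] by simp
    have "A \<times> B = (\<lambda>z. (fst z, \<phi> (snd z))) -` (A \<times> \<psi> -` B) \<inter> space \<eta>"
      using sp inv sets.sets_into_space[OF A] sets.sets_into_space[OF B] sets_eq_imp_space_eq[OF sets]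
      by (auto simp: space_pair_measure)
    then have "emeasure \<eta> (A \<times> B) = emeasure \<eta>' (A \<times> \<psi> -` B)"
      unfolding \<eta>'_def using emeasure_distr[OF g] A B' by simp
    also have "\<dots> = (\<integral>\<^sup>+y\<in>A. emeasure (\<kappa> y) (\<psi> -` B) \<partial>\<tau>)"
      by (rule disintegrationD(6)[OF \<kappa> A B'])
    also have "\<dots> = (\<integral>\<^sup>+y\<in>A. emeasure (distr (\<kappa> y) M \<psi>) B \<partial>\<tau>)"
    proof (rule nn_integral_cong)
      fix y assume "y \<in> space \<tau>"
      then have s: "sets (\<kappa> y) = sets borel"
        using measurable_space[OF \<kappa>m] by (simp add: space_prob_algebra)
      have "\<psi> \<in> \<kappa> y \<rightarrow>\<^sub>M M" using \<psi> by (simp add: measurable_cong_sets[OF s refl])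
      then show "emeasure (\<kappa> y) (\<psi> -` B) * indicator A y = emeasure (distr (\<kappa> y) M \<psi>) B * indicator A y"
        using B sets_eq_imp_space_eq[OF s] by (simp add: emeasure_distr)
    qed
    finally show "emeasure \<eta> (A \<times> B) = (\<integral>\<^sup>+y\<in>A. emeasure (distr (\<kappa> y) M \<psi>) B \<partial>\<tau>)" .
  qed
  then show ?thesis by blast
qed

section \<open>The correspondence\<close>

locale random_iteration = markov_chain E p q m P
  for E :: "'e measure" and p q :: "'e \<Rightarrow> 'e measure" and m :: "'e measure"
    and P :: "(nat \<Rightarrow> 'e) measure" +
  fixes M :: "'x measure" and f :: "'e \<Rightarrow> 'x \<Rightarrow> 'x"
  assumes f: "(\<lambda>(a, x). f a x) \<in> E \<Otimes>\<^sub>M M \<rightarrow>\<^sub>M M"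
begin

lemma measurable_f_comp:
  assumes "a \<in> N \<rightarrow>\<^sub>M E" "x \<in> N \<rightarrow>\<^sub>M M"
  shows "(\<lambda>z. f (a z) (x z)) \<in> N \<rightarrow>\<^sub>M M"
  using measurable_compose[OF measurable_Pair[OF assms] f] by simp

lemma measurable_f_section: "a \<in> space E \<Longrightarrow> f a \<in> M \<rightarrow>\<^sub>M M"
  using measurable_f_comp[of "\<lambda>_. a" M "\<lambda>x. x"] by simp

text \<open>The law of the state \<open>(\<omega> 0, f\<^bsub>\<omega> 0\<^esub> x)\<close> after the first step. This is the map \<open>\<mu>h \<mapsto> \<nu>\<close> of the
correspondence, defined without choosing a disintegration.\<close>
definition state_law :: "((nat \<Rightarrow> 'e) \<times> 'x) measure \<Rightarrow> ('e \<times> 'x) measure" where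
  "state_law \<mu>h = distr \<mu>h (E \<Otimes>\<^sub>M M) (\<lambda>z. (fst z 0, f (fst z 0) (snd z)))"

lemma measurable_first_step:
  "(\<lambda>z. fst z i) \<in> P \<Otimes>\<^sub>M M \<rightarrow>\<^sub>M E"
  "(\<lambda>z. f (fst z 0) (snd z)) \<in> P \<Otimes>\<^sub>M M \<rightarrow>\<^sub>M M"
proof -
  show c: "(\<lambda>z. fst z i) \<in> P \<Otimes>\<^sub>M M \<rightarrow>\<^sub>M E" for i
    by (rule measurable_compose[OF measurable_fst coordinate])
  show "(\<lambda>z. f (fst z 0) (snd z)) \<in> P \<Otimes>\<^sub>M M \<rightarrow>\<^sub>M M"
    by (rule measurable_f_comp[OF c measurable_snd])
qed

lemma sets_path_pair: "sets (P \<Otimes>\<^sub>M M) = sets (path_space E \<Otimes>\<^sub>M M)"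
  by (rule sets_pair_measure_cong[OF sets_P refl])

lemma measurable_skew_product: "skew_product f \<in> P \<Otimes>\<^sub>M M \<rightarrow>\<^sub>M path_space E \<Otimes>\<^sub>M M"
  unfolding skew_product_def case_prod_unfold
  by (intro measurable_Pair measurable_first_step(2) measurable_compose[OF measurable_fst shift])

lemma measurable_pushed_kernel:
  assumes \<mu>: "\<mu> \<in> E \<rightarrow>\<^sub>M prob_algebra M"
  shows "(\<lambda>\<alpha>. distr (\<mu> \<alpha>) M (f \<alpha>)) \<in> E \<rightarrow>\<^sub>M prob_algebra M"
  by (rule measurable_distr_prob_space2[OF \<mu> f])

lemma emeasure_pushed_kernel:
  assumes \<mu>: "\<mu> \<in> E \<rightarrow>\<^sub>M prob_algebra M" and \<alpha>: "\<alpha> \<in> space E" and B: "B \<in> sets M"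
  shows "emeasure (distr (\<mu> \<alpha>) M (f \<alpha>)) B = (\<integral>\<^sup>+x. indicator B (f \<alpha> x) \<partial>\<mu> \<alpha>)"
proof -
  have "f \<alpha> \<in> \<mu> \<alpha> \<rightarrow>\<^sub>M M"
    using measurable_f_section[OF \<alpha>] unfolding measurable_cong_sets[OF kernel_space(1)[OF \<mu> \<alpha>] refl] .
  from emeasure_distr_nn_integral[OF this B] show ?thesis .
qed

text \<open>Evaluate along constant trajectories.\<close>
lemma measurable_family:
  assumes "(\<lambda>\<omega>. \<mu> (\<omega> 0)) \<in> P \<rightarrow>\<^sub>M L"
  shows "\<mu> \<in> E \<rightarrow>\<^sub>M L"
proof -
  have "(\<lambda>\<alpha> n. \<alpha>) \<in> E \<rightarrow>\<^sub>M P"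
    unfolding measurable_cong_sets[OF refl sets_P]
    by (rule measurable_PiM_single') (auto simp: space_PiM)
  from measurable_compose[OF this assms] show ?thesis by simp
qed

lemma measurable_m_iff: "g \<in> E \<rightarrow>\<^sub>M L \<longleftrightarrow> g \<in> m \<rightarrow>\<^sub>M L"
  by (simp add: measurable_cong_sets[OF sets_m refl])

lemma measurable_q_average:
  assumes \<nu>: "\<nu> \<in> E \<rightarrow>\<^sub>M prob_algebra M"
  shows "(\<lambda>\<alpha>. q \<alpha> \<bind> \<nu>) \<in> E \<rightarrow>\<^sub>M prob_algebra M"
  using transition_q unfolding transition_prob_def by (rule measurable_bind_prob_space[OF _ \<nu>])

lemma nn_integral_q_average:
  assumes \<nu>: "\<nu> \<in> E \<rightarrow>\<^sub>M prob_algebra M" and h: "h \<in> borel_measurable M" and \<alpha>: "\<alpha> \<in> space E"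
  shows "(\<integral>\<^sup>+x. h x \<partial>(q \<alpha> \<bind> \<nu>)) = (\<integral>\<^sup>+\<beta>. \<integral>\<^sup>+x. h x \<partial>\<nu> \<beta> \<partial>q \<alpha>)"
proof (rule nn_integral_bind[OF h])
  show "\<nu> \<in> q \<alpha> \<rightarrow>\<^sub>M subprob_algebra M"
    using measurable_prob_algebraD[OF \<nu>]
    unfolding measurable_cong_sets[OF transition_prob_space(1)[OF transition_q \<alpha>] refl] .
qed

lemma disintegration_state_law:
  assumes d: "disintegration P M \<mu>h (\<lambda>\<omega>. \<mu> (\<omega> 0))"
  shows "disintegration m M (state_law \<mu>h) (\<lambda>\<alpha>. distr (\<mu> \<alpha>) M (f \<alpha>))"
proof (rule disintegrationI[OF prob_m])
  have \<mu>: "\<mu> \<in> E \<rightarrow>\<^sub>M prob_algebra M"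
    by (rule measurable_family[OF disintegrationD(5)[OF d]])
  note \<nu> = measurable_pushed_kernel[OF \<mu>]
  have s: "sets \<mu>h = sets (P \<Otimes>\<^sub>M M)" by (rule disintegrationD(2)[OF d])
  show "sets (state_law \<mu>h) = sets (m \<Otimes>\<^sub>M M)"
    by (simp add: state_law_def sets_m cong: sets_pair_measure_cong)
  show "(\<lambda>\<alpha>. distr (\<mu> \<alpha>) M (f \<alpha>)) \<in> m \<rightarrow>\<^sub>M prob_algebra M"
    using \<nu> by (simp only: measurable_m_iff)
  fix A B assume A': "A \<in> sets m" and B: "B \<in> sets M"
  then have A: "A \<in> sets E" by (simp add: sets_m)
  have step: "(\<lambda>z. (fst z 0, f (fst z 0) (snd z))) \<in> P \<Otimes>\<^sub>M M \<rightarrow>\<^sub>M E \<Otimes>\<^sub>M M"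
    by (intro measurable_Pair measurable_first_step)
  have AB: "A \<times> B \<in> sets (E \<Otimes>\<^sub>M M)" using A B by simp
  have "emeasure (state_law \<mu>h) (A \<times> B) = (\<integral>\<^sup>+z. indicator (A \<times> B) (fst z 0, f (fst z 0) (snd z)) \<partial>\<mu>h)"
    unfolding state_law_def
    by (rule emeasure_distr_nn_integral[OF _ AB]) (unfold measurable_cong_sets[OF s refl], rule step)
  also have "\<dots> = (\<integral>\<^sup>+\<omega>. \<integral>\<^sup>+x. indicator (A \<times> B) (\<omega> 0, f (\<omega> 0) x) \<partial>\<mu> (\<omega> 0) \<partial>P)"
    by (subst nn_integral_disintegration[OF d measurable_compose[OF step borel_measurable_indicator[OF AB]]]) simp
  also have "\<dots> = (\<integral>\<^sup>+\<omega>. emeasure (distr (\<mu> (\<omega> 0)) M (f (\<omega> 0))) B * indicator A (\<omega> 0) \<partial>P)"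
  proof (rule nn_integral_cong)
    fix \<omega> assume "\<omega> \<in> space P"
    then have "\<omega> 0 \<in> space E" by (rule measurable_space[OF coordinate])
    then show "(\<integral>\<^sup>+x. indicator (A \<times> B) (\<omega> 0, f (\<omega> 0) x) \<partial>\<mu> (\<omega> 0)) =
        emeasure (distr (\<mu> (\<omega> 0)) M (f (\<omega> 0))) B * indicator A (\<omega> 0)"
      by (simp add: emeasure_pushed_kernel[OF \<mu> _ B] indicator_times split: split_indicator)
  qed
  also have "\<dots> = (\<integral>\<^sup>+\<alpha>\<in>A. emeasure (distr (\<mu> \<alpha>) M (f \<alpha>)) B \<partial>m)"
    using measurable_emeasure_kernel[OF \<nu> B] A by (intro nn_integral_initial_coordinate) auto
  finally show "emeasure (state_law \<mu>h) (A \<times> B) = \<dots>" .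
qed

text \<open>Under the skew product a point \<open>(\<omega>, x)\<close> goes to the shifted trajectory with fibre position
\<open>f\<^bsub>\<omega> 0\<^esub> x\<close>, whose law given \<open>\<omega> 0\<close> is \<open>\<nu> (\<omega> 0)\<close>. The coordinate \<open>\<omega> 0\<close> is the past of the
shifted trajectory, and given that trajectory it is averaged with respect to \<open>q\<close>.\<close>
lemma disintegration_skew_product:
  assumes d: "disintegration P M \<mu>h (\<lambda>\<omega>. \<mu> (\<omega> 0))"
    and d': "disintegration m M (state_law \<mu>h) \<nu>"
  shows "disintegration P M (distr \<mu>h (path_space E \<Otimes>\<^sub>M M) (skew_product f)) (\<lambda>\<omega>. q (\<omega> 0) \<bind> \<nu>)"
proof (rule disintegrationI[OF prob_P])
  let ?s = "\<lambda>\<omega> n. \<omega> (Suc n) :: 'e"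
  have \<mu>: "\<mu> \<in> E \<rightarrow>\<^sub>M prob_algebra M"
    by (rule measurable_family[OF disintegrationD(5)[OF d]])
  have \<nu>: "\<nu> \<in> E \<rightarrow>\<^sub>M prob_algebra M"
    using disintegrationD(5)[OF d'] by (simp only: measurable_m_iff)
  have s: "sets \<mu>h = sets (P \<Otimes>\<^sub>M M)" by (rule disintegrationD(2)[OF d])
  show "sets (distr \<mu>h (path_space E \<Otimes>\<^sub>M M) (skew_product f)) = sets (P \<Otimes>\<^sub>M M)"
    by (simp only: sets_distr sets_path_pair)
  show "(\<lambda>\<omega>. q (\<omega> 0) \<bind> \<nu>) \<in> P \<rightarrow>\<^sub>M prob_algebra M"
    by (rule measurable_compose[OF coordinate measurable_q_average[OF \<nu>]])
  fix C B assume C': "C \<in> sets P" and B: "B \<in> sets M"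
  then have C: "C \<in> sets (path_space E)" by (simp only: sets_P)
  have CB: "C \<times> B \<in> sets (path_space E \<Otimes>\<^sub>M M)" using C B by simp
  have \<nu>B: "(\<lambda>\<beta>. emeasure (\<nu> \<beta>) B) \<in> borel_measurable E"
    by (rule measurable_emeasure_kernel[OF \<nu> B])
  have ae: "AE \<omega> in P. emeasure (distr (\<mu> (\<omega> 0)) M (f (\<omega> 0))) B = emeasure (\<nu> (\<omega> 0)) B"
  proof -
    have "AE \<alpha> in distr P E (\<lambda>\<omega>. \<omega> 0). emeasure (distr (\<mu> \<alpha>) M (f \<alpha>)) B = emeasure (\<nu> \<alpha>) B"
      unfolding distr_initial by (rule disintegration_AE_unique[OF disintegration_state_law[OF d] d' B])
    from AE_distrD[OF coordinate this] show ?thesis .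
  qed
  have "emeasure (distr \<mu>h (path_space E \<Otimes>\<^sub>M M) (skew_product f)) (C \<times> B) =
      (\<integral>\<^sup>+z. indicator (C \<times> B) (skew_product f z) \<partial>\<mu>h)"
    by (rule emeasure_distr_nn_integral[OF _ CB])
       (unfold measurable_cong_sets[OF s refl], rule measurable_skew_product)
  also have "\<dots> = (\<integral>\<^sup>+\<omega>. \<integral>\<^sup>+x. indicator (C \<times> B) (?s \<omega>, f (\<omega> 0) x) \<partial>\<mu> (\<omega> 0) \<partial>P)"
    by (subst nn_integral_disintegration[OF d measurable_compose[OF measurable_skew_product borel_measurable_indicator[OF CB]]])
       (simp add: skew_product_def)
  also have "\<dots> = (\<integral>\<^sup>+\<omega>. indicator C (?s \<omega>) * emeasure (distr (\<mu> (\<omega> 0)) M (f (\<omega> 0))) B \<partial>P)"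
  proof (rule nn_integral_cong)
    fix \<omega> assume "\<omega> \<in> space P"
    then have "\<omega> 0 \<in> space E" by (rule measurable_space[OF coordinate])
    then show "(\<integral>\<^sup>+x. indicator (C \<times> B) (?s \<omega>, f (\<omega> 0) x) \<partial>\<mu> (\<omega> 0)) =
        indicator C (?s \<omega>) * emeasure (distr (\<mu> (\<omega> 0)) M (f (\<omega> 0))) B"
      by (simp add: emeasure_pushed_kernel[OF \<mu> _ B] indicator_times split: split_indicator)
  qed
  also have "\<dots> = (\<integral>\<^sup>+\<omega>. indicator C (?s \<omega>) * emeasure (\<nu> (\<omega> 0)) B \<partial>P)"
    by (rule nn_integral_cong_AE, rule eventually_mono[OF ae]) simp
  also have "\<dots> = (\<integral>\<^sup>+z. indicator C (fst z) * emeasure (\<nu> (snd z)) B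
      \<partial>distr P (path_space E \<Otimes>\<^sub>M E) (\<lambda>\<omega>. (?s \<omega>, \<omega> 0)))"
  proof -
    have "(\<lambda>\<omega>. (?s \<omega>, \<omega> 0)) \<in> P \<rightarrow>\<^sub>M path_space E \<Otimes>\<^sub>M E"
      by (intro measurable_Pair coordinate shift)
    moreover have "(\<lambda>z. indicator C (fst z) * emeasure (\<nu> (snd z)) B) \<in> borel_measurable (path_space E \<Otimes>\<^sub>M E)"
      by (intro borel_measurable_times_ennreal measurable_compose[OF measurable_snd \<nu>B]
          measurable_compose[OF measurable_fst borel_measurable_indicator[OF C]])
    ultimately show ?thesis by (simp only: nn_integral_distr measurable_distr_eq1 fst_conv snd_conv)
  qed
  also have "\<dots> = (\<integral>\<^sup>+\<omega>. \<integral>\<^sup>+\<beta>. indicator C \<omega> * emeasure (\<nu> \<beta>) B \<partial>q (\<omega> 0) \<partial>P)"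
  proof -
    have "(\<lambda>z. indicator C (fst z) * emeasure (\<nu> (snd z)) B) \<in> borel_measurable (P \<Otimes>\<^sub>M E)"
      by (intro borel_measurable_times_ennreal measurable_compose[OF measurable_snd \<nu>B]
          measurable_compose[OF measurable_fst borel_measurable_indicator[OF C']])
    from nn_integral_disintegration[OF past_given_future this] show ?thesis by simp
  qed
  also have "\<dots> = (\<integral>\<^sup>+\<omega>\<in>C. emeasure (q (\<omega> 0) \<bind> \<nu>) B \<partial>P)"
  proof (rule nn_integral_cong)
    fix \<omega> assume "\<omega> \<in> space P"
    then have \<omega>: "\<omega> 0 \<in> space E" by (rule measurable_space[OF coordinate])
    have "emeasure (q (\<omega> 0) \<bind> \<nu>) B = (\<integral>\<^sup>+\<beta>. emeasure (\<nu> \<beta>) B \<partial>q (\<omega> 0))"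
      using measurable_space[of q E "prob_algebra E"] transition_q \<omega>
      by (intro emeasure_bind_prob_algebra[OF _ \<nu> B]) (simp add: transition_prob_def)
    then show "(\<integral>\<^sup>+\<beta>. indicator C \<omega> * emeasure (\<nu> \<beta>) B \<partial>q (\<omega> 0)) = emeasure (q (\<omega> 0) \<bind> \<nu>) B * indicator C \<omega>"
      by (simp split: split_indicator)
  qed
  finally show "emeasure (distr \<mu>h (path_space E \<Otimes>\<^sub>M M) (skew_product f)) (C \<times> B) = \<dots>" .
qed

lemma measurable_hat_transition:
  "hat_transition E M p f \<in> E \<Otimes>\<^sub>M M \<rightarrow>\<^sub>M prob_algebra (E \<Otimes>\<^sub>M M)"
proof -
  have p': "(\<lambda>z. p (fst z)) \<in> E \<Otimes>\<^sub>M M \<rightarrow>\<^sub>M prob_algebra E"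
    using p unfolding transition_prob_def by (rule measurable_compose[OF measurable_fst])
  have "(\<lambda>(z, b). (b, f b (snd z))) \<in> (E \<Otimes>\<^sub>M M) \<Otimes>\<^sub>M E \<rightarrow>\<^sub>M E \<Otimes>\<^sub>M M"
    unfolding case_prod_unfold
    by (intro measurable_Pair measurable_f_comp measurable_snd measurable_compose[OF measurable_fst measurable_snd])
  from measurable_distr_prob_space2[OF p' this] show ?thesis
    by (simp add: hat_transition_def case_prod_unfold)
qed

lemma emeasure_hat_transition:
  assumes a: "a \<in> space E" and x: "x \<in> space M" and D: "D \<in> sets (E \<Otimes>\<^sub>M M)"
  shows "emeasure (hat_transition E M p f (a, x)) D = (\<integral>\<^sup>+b. indicator D (b, f b x) \<partial>p a)"
proof -
  have "(\<lambda>b. (b, f b x)) \<in> E \<rightarrow>\<^sub>M E \<Otimes>\<^sub>M M"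
    using x by (intro measurable_Pair measurable_f_comp) auto
  then have "(\<lambda>b. (b, f b x)) \<in> p a \<rightarrow>\<^sub>M E \<Otimes>\<^sub>M M"
    unfolding measurable_cong_sets[OF transition_prob_space(1)[OF p a] refl] .
  from emeasure_distr_nn_integral[OF this D] show ?thesis by (simp add: hat_transition_def)
qed

lemma measurable_kernel_integral:
  assumes \<nu>: "\<nu> \<in> E \<rightarrow>\<^sub>M prob_algebra M" and D: "D \<in> sets (E \<Otimes>\<^sub>M M)"
  shows "(\<lambda>z. \<integral>\<^sup>+x. indicator D (snd z, f (snd z) x) \<partial>\<nu> (fst z) :: ennreal) \<in> borel_measurable (E \<Otimes>\<^sub>M E)"
proof (rule nn_integral_measurable_subprob_algebra2)
  show "(\<lambda>z. \<nu> (fst z)) \<in> E \<Otimes>\<^sub>M E \<rightarrow>\<^sub>M subprob_algebra M"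
    by (rule measurable_compose[OF measurable_fst measurable_prob_algebraD[OF \<nu>]])
  have "(\<lambda>w. (snd (fst w), f (snd (fst w)) (snd w))) \<in> (E \<Otimes>\<^sub>M E) \<Otimes>\<^sub>M M \<rightarrow>\<^sub>M E \<Otimes>\<^sub>M M"
    by (intro measurable_Pair measurable_f_comp measurable_snd measurable_compose[OF measurable_fst measurable_snd])
  from measurable_compose[OF this borel_measurable_indicator[OF D]]
  show "(\<lambda>(z, x). indicator D (snd z, f (snd z) x) :: ennreal) \<in> borel_measurable ((E \<Otimes>\<^sub>M E) \<Otimes>\<^sub>M M)"
    by (simp add: case_prod_unfold)
qed

text \<open>One step of the chain on \<open>E \<times> M\<close>, started from \<open>\<eta>\<close>, in terms of the first two coordinates of the
base chain, which is where \<open>p\<close> can be exchanged for \<open>q\<close>.\<close>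
lemma nn_integral_hat_transition:
  assumes d: "disintegration m M \<eta> \<nu>" and D: "D \<in> sets (E \<Otimes>\<^sub>M M)"
  shows "(\<integral>\<^sup>+z. emeasure (hat_transition E M p f z) D \<partial>\<eta>) =
    (\<integral>\<^sup>+\<omega>. \<integral>\<^sup>+x. indicator D (\<omega> 1, f (\<omega> 1) x) \<partial>\<nu> (\<omega> 0) \<partial>P)"
proof -
  have \<nu>: "\<nu> \<in> E \<rightarrow>\<^sub>M prob_algebra M"
    using disintegrationD(5)[OF d] by (simp only: measurable_m_iff)
  have sm: "sets (m \<Otimes>\<^sub>M L) = sets (E \<Otimes>\<^sub>M L)" for L :: "'l measure"
    by (rule sets_pair_measure_cong[OF sets_m refl])
  have hat: "(\<lambda>z. emeasure (hat_transition E M p f z) D) \<in> borel_measurable (m \<Otimes>\<^sub>M M)"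
    unfolding measurable_cong_sets[OF sm refl]
    by (rule measurable_emeasure_kernel[OF measurable_hat_transition D])
  have "(\<integral>\<^sup>+z. emeasure (hat_transition E M p f z) D \<partial>\<eta>) =
      (\<integral>\<^sup>+\<alpha>. \<integral>\<^sup>+x. emeasure (hat_transition E M p f (\<alpha>, x)) D \<partial>\<nu> \<alpha> \<partial>m)"
    by (rule nn_integral_disintegration[OF d hat])
  also have "\<dots> = (\<integral>\<^sup>+\<alpha>. \<integral>\<^sup>+\<beta>. \<integral>\<^sup>+x. indicator D (\<beta>, f \<beta> x) \<partial>\<nu> \<alpha> \<partial>p \<alpha> \<partial>m)"
  proof (rule nn_integral_cong)
    fix \<alpha> assume "\<alpha> \<in> space m"
    then have \<alpha>: "\<alpha> \<in> space E" using sets_eq_imp_space_eq[OF sets_m] by simp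
    interpret \<nu>: prob_space "\<nu> \<alpha>" by (rule kernel_space(2)[OF \<nu> \<alpha>])
    interpret p: prob_space "p \<alpha>" by (rule transition_prob_space(2)[OF p \<alpha>])
    interpret pair_sigma_finite "\<nu> \<alpha>" "p \<alpha>" ..
    have s\<nu>: "sets (\<nu> \<alpha>) = sets M" and sp: "sets (p \<alpha>) = sets E"
      by (rule kernel_space(1)[OF \<nu> \<alpha>], rule transition_prob_space(1)[OF p \<alpha>])
    have sn: "sets (\<nu> \<alpha> \<Otimes>\<^sub>M p \<alpha>) = sets (M \<Otimes>\<^sub>M E)"
      by (rule sets_pair_measure_cong[OF s\<nu> sp])
    have "(\<lambda>w. (snd w, f (snd w) (fst w))) \<in> M \<Otimes>\<^sub>M E \<rightarrow>\<^sub>M E \<Otimes>\<^sub>M M"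
      by (intro measurable_Pair measurable_f_comp measurable_snd measurable_fst)
    from measurable_compose[OF this borel_measurable_indicator[OF D]]
    have meas: "(\<lambda>(x, \<beta>). indicator D (\<beta>, f \<beta> x) :: ennreal) \<in> borel_measurable (\<nu> \<alpha> \<Otimes>\<^sub>M p \<alpha>)"
      unfolding measurable_cong_sets[OF sn refl] by (simp add: case_prod_unfold)
    have "(\<integral>\<^sup>+x. emeasure (hat_transition E M p f (\<alpha>, x)) D \<partial>\<nu> \<alpha>) =
        (\<integral>\<^sup>+x. \<integral>\<^sup>+\<beta>. indicator D (\<beta>, f \<beta> x) \<partial>p \<alpha> \<partial>\<nu> \<alpha>)"
      using sets_eq_imp_space_eq[OF s\<nu>] by (intro nn_integral_cong emeasure_hat_transition[OF \<alpha> _ D]) simp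
    also have "\<dots> = (\<integral>\<^sup>+\<beta>. \<integral>\<^sup>+x. indicator D (\<beta>, f \<beta> x) \<partial>\<nu> \<alpha> \<partial>p \<alpha>)"
      by (rule Fubini'[OF meas, symmetric])
    finally show "(\<integral>\<^sup>+x. emeasure (hat_transition E M p f (\<alpha>, x)) D \<partial>\<nu> \<alpha>) = \<dots>" .
  qed
  also have "\<dots> = (\<integral>\<^sup>+z. \<integral>\<^sup>+x. indicator D (snd z, f (snd z) x) \<partial>\<nu> (fst z)
      \<partial>distr P (E \<Otimes>\<^sub>M E) (\<lambda>\<omega>. (\<omega> 0, \<omega> 1)))"
  proof -
    have "(\<lambda>z. \<integral>\<^sup>+x. indicator D (snd z, f (snd z) x) \<partial>\<nu> (fst z) :: ennreal) \<in> borel_measurable (m \<Otimes>\<^sub>M E)"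
      unfolding measurable_cong_sets[OF sm refl] by (rule measurable_kernel_integral[OF \<nu> D])
    from nn_integral_disintegration[OF next_given_initial this] show ?thesis by simp
  qed
  also have "\<dots> = (\<integral>\<^sup>+\<omega>. \<integral>\<^sup>+x. indicator D (\<omega> 1, f (\<omega> 1) x) \<partial>\<nu> (\<omega> 0) \<partial>P)"
  proof -
    have "(\<lambda>\<omega>. (\<omega> 0, \<omega> 1)) \<in> P \<rightarrow>\<^sub>M E \<Otimes>\<^sub>M E"
      by (intro measurable_Pair coordinate)
    with measurable_kernel_integral[OF \<nu> D] show ?thesis
      by (simp only: nn_integral_distr measurable_distr_eq1 fst_conv snd_conv)
  qed
  finally show ?thesis .
qed

lemma I0_iff_skew_product_invariant:
  assumes d: "disintegration P M \<mu>h (\<lambda>\<omega>. \<mu> (\<omega> 0))"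
  shows "\<mu>h \<in> I0_measures E M P f \<longleftrightarrow> distr \<mu>h (path_space E \<Otimes>\<^sub>M M) (skew_product f) = \<mu>h"
proof -
  have "distr \<mu>h (path_space E) fst = P"
    using disintegrationD(4)[OF d] distr_cong[OF refl sets_P, of \<mu>h fst fst] by simp
  moreover have "\<mu>h \<in> space (prob_algebra (path_space E \<Otimes>\<^sub>M M))"
    using disintegrationD(1,2)[OF d] by (simp add: space_prob_algebra sets_path_pair)
  ultimately show ?thesis
    using d by (auto simp: I0_measures_def invariant_measures_def)
qed

text \<open>Applying the skew product before taking the state law amounts to one more step of the chain on
\<open>E \<times> M\<close>, and invariance says that it changes nothing.\<close>
lemma state_law_stationary:
  assumes \<mu>h: "\<mu>h \<in> I0_measures E M P f"
  shows "state_law \<mu>h \<in> S_measures E M p f"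
proof -
  from \<mu>h obtain \<mu> where d: "disintegration P M \<mu>h (\<lambda>\<omega>. \<mu> (\<omega> 0))"
    by (auto simp: I0_measures_def)
  have inv: "distr \<mu>h (path_space E \<Otimes>\<^sub>M M) (skew_product f) = \<mu>h"
    using \<mu>h I0_iff_skew_product_invariant[OF d] by simp
  have \<mu>: "\<mu> \<in> E \<rightarrow>\<^sub>M prob_algebra M"
    by (rule measurable_family[OF disintegrationD(5)[OF d]])
  define \<nu> where "\<nu> \<alpha> = distr (\<mu> \<alpha>) M (f \<alpha>)" for \<alpha>
  have d': "disintegration m M (state_law \<mu>h) \<nu>"
    using disintegration_state_law[OF d] by (simp add: \<nu>_def[abs_def])
  have s: "sets \<mu>h = sets (P \<Otimes>\<^sub>M M)" by (rule disintegrationD(2)[OF d])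
  have space: "state_law \<mu>h \<in> space (prob_algebra (E \<Otimes>\<^sub>M M))"
    using disintegrationD(1)[OF d'] by (simp add: space_prob_algebra state_law_def)
  have step: "(\<lambda>z. (fst z 0, f (fst z 0) (snd z))) \<in> P \<Otimes>\<^sub>M M \<rightarrow>\<^sub>M E \<Otimes>\<^sub>M M"
    by (intro measurable_Pair measurable_first_step)
  have F: "skew_product f \<in> \<mu>h \<rightarrow>\<^sub>M P \<Otimes>\<^sub>M M"
    using measurable_skew_product unfolding measurable_cong_sets[OF s sets_path_pair] .
  have "emeasure (state_law \<mu>h) D = (\<integral>\<^sup>+z. emeasure (hat_transition E M p f z) D \<partial>state_law \<mu>h)"
    if D: "D \<in> sets (E \<Otimes>\<^sub>M M)" for D
  proof -
    have step2: "(\<lambda>z. (fst z 1, f (fst z 1) (f (fst z 0) (snd z)))) \<in> P \<Otimes>\<^sub>M M \<rightarrow>\<^sub>M E \<Otimes>\<^sub>M M"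
      by (intro measurable_Pair measurable_f_comp measurable_first_step)
    have "emeasure (state_law \<mu>h) D = emeasure (state_law (distr \<mu>h (P \<Otimes>\<^sub>M M) (skew_product f))) D"
      using inv distr_cong[OF refl sets_path_pair, of \<mu>h "skew_product f" "skew_product f"] by simp
    also have "\<dots> = emeasure (distr \<mu>h (E \<Otimes>\<^sub>M M) (\<lambda>z. (fst z 1, f (fst z 1) (f (fst z 0) (snd z))))) D"
      unfolding state_law_def distr_distr[OF step F] by (simp add: comp_def skew_product_def case_prod_unfold)
    also have "\<dots> = (\<integral>\<^sup>+z. indicator D (fst z 1, f (fst z 1) (f (fst z 0) (snd z))) \<partial>\<mu>h)"
      by (rule emeasure_distr_nn_integral[OF _ D]) (unfold measurable_cong_sets[OF s refl], rule step2)
    also have "\<dots> = (\<integral>\<^sup>+\<omega>. \<integral>\<^sup>+x. indicator D (\<omega> 1, f (\<omega> 1) (f (\<omega> 0) x)) \<partial>\<mu> (\<omega> 0) \<partial>P)"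
      by (subst nn_integral_disintegration[OF d measurable_compose[OF step2 borel_measurable_indicator[OF D]]]) simp
    also have "\<dots> = (\<integral>\<^sup>+\<omega>. \<integral>\<^sup>+x. indicator D (\<omega> 1, f (\<omega> 1) x) \<partial>\<nu> (\<omega> 0) \<partial>P)"
    proof (rule nn_integral_cong)
      fix \<omega> assume "\<omega> \<in> space P"
      then have \<omega>: "\<omega> i \<in> space E" for i by (rule measurable_space[OF coordinate])
      have f0: "f (\<omega> 0) \<in> \<mu> (\<omega> 0) \<rightarrow>\<^sub>M M"
        using measurable_f_section[OF \<omega>] unfolding measurable_cong_sets[OF kernel_space(1)[OF \<mu> \<omega>] refl] .
      have "(\<lambda>x. (\<omega> 1, f (\<omega> 1) x)) \<in> M \<rightarrow>\<^sub>M E \<Otimes>\<^sub>M M"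
        using \<omega> by (intro measurable_Pair measurable_f_section) auto
      from measurable_compose[OF this borel_measurable_indicator[OF D]]
      have "(\<lambda>x. indicator D (\<omega> 1, f (\<omega> 1) x) :: ennreal) \<in> borel_measurable M" .
      with f0 show "(\<integral>\<^sup>+x. indicator D (\<omega> 1, f (\<omega> 1) (f (\<omega> 0) x)) \<partial>\<mu> (\<omega> 0)) =
          (\<integral>\<^sup>+x. indicator D (\<omega> 1, f (\<omega> 1) x) \<partial>\<nu> (\<omega> 0) :: ennreal)"
        unfolding \<nu>_def by (simp only: nn_integral_distr measurable_distr_eq1)
    qed
    also have "\<dots> = (\<integral>\<^sup>+z. emeasure (hat_transition E M p f z) D \<partial>state_law \<mu>h)"
      by (rule nn_integral_hat_transition[OF d' D, symmetric])
    finally show ?thesis .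
  qed
  with space show ?thesis by (simp add: S_measures_def stationary_measures_def)
qed

text \<open>An invariant measure is its own image under the skew product. This is the formula for the inverse
of \<^const>\<open>state_law\<close>, and it makes \<^const>\<open>state_law\<close> injective.\<close>
lemma disintegration_of_invariant:
  assumes \<mu>h: "\<mu>h \<in> I0_measures E M P f" and d': "disintegration m M (state_law \<mu>h) \<nu>"
  shows "disintegration P M \<mu>h (\<lambda>\<omega>. q (\<omega> 0) \<bind> \<nu>)"
proof -
  from \<mu>h obtain \<mu> where d: "disintegration P M \<mu>h (\<lambda>\<omega>. \<mu> (\<omega> 0))"
    by (auto simp: I0_measures_def)
  have "distr \<mu>h (path_space E \<Otimes>\<^sub>M M) (skew_product f) = \<mu>h"
    using \<mu>h I0_iff_skew_product_invariant[OF d] by simp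
  with disintegration_skew_product[OF d d'] show ?thesis by simp
qed

lemma inj_on_state_law: "inj_on state_law (I0_measures E M P f)"
proof (rule inj_onI)
  fix \<mu>h \<mu>h' assume I: "\<mu>h \<in> I0_measures E M P f" "\<mu>h' \<in> I0_measures E M P f"
    and eq: "state_law \<mu>h = state_law \<mu>h'"
  from I(1) obtain \<mu> where "disintegration P M \<mu>h (\<lambda>\<omega>. \<mu> (\<omega> 0))"
    by (auto simp: I0_measures_def)
  from disintegration_state_law[OF this]
  obtain \<nu> where \<nu>: "disintegration m M (state_law \<mu>h) \<nu>" by blast
  then have \<nu>': "disintegration m M (state_law \<mu>h') \<nu>" by (simp only: eq)
  show "\<mu>h = \<mu>h'"
    by (rule disintegration_determines_measure[OF disintegration_of_invariant[OF I(1) \<nu>]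
          disintegration_of_invariant[OF I(2) \<nu>']])
qed

text \<open>On a rectangle \<open>A \<times> B\<close>, the state law of the backward average integrates
\<open>\<nu>\<^sub>\<beta> (f\<^sub>\<alpha>\<^sup>-\<^sup>1 B)\<close> over \<open>\<alpha> \<in> A\<close> and \<open>\<beta>\<close> drawn from \<open>q \<alpha>\<close>. Duality lets \<open>\<beta>\<close> be drawn first and \<open>\<alpha>\<close> from
\<open>p \<beta>\<close>; this is one step of the chain on \<open>E \<times> M\<close> started from \<open>\<eta>\<close>, which leaves \<open>\<eta>\<close> unchanged.\<close>
lemma state_law_of_backward_average:
  assumes S: "\<eta> \<in> S_measures E M p f" and d: "disintegration m M \<eta> \<nu>"
    and d': "disintegration P M \<mu>h (\<lambda>\<omega>. q (\<omega> 0) \<bind> \<nu>)"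
  shows "state_law \<mu>h = \<eta>"
proof (rule measure_eqI_rectangles[where Y = E and N = M])
  have \<nu>: "\<nu> \<in> E \<rightarrow>\<^sub>M prob_algebra M"
    using disintegrationD(5)[OF d] by (simp only: measurable_m_iff)
  note \<mu> = measurable_q_average[OF \<nu>]
  have sm: "sets (m \<Otimes>\<^sub>M L) = sets (E \<Otimes>\<^sub>M L)" for L :: "'l measure"
    by (rule sets_pair_measure_cong[OF sets_m refl])
  have ds: "disintegration m M (state_law \<mu>h) (\<lambda>\<alpha>. distr (q \<alpha> \<bind> \<nu>) M (f \<alpha>))"
    by (rule disintegration_state_law) (rule d')
  show "sets (state_law \<mu>h) = sets (E \<Otimes>\<^sub>M M)" by (simp add: state_law_def)
  show "sets \<eta> = sets (E \<Otimes>\<^sub>M M)" using disintegrationD(2)[OF d] by (simp only: sm)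
  show "finite_measure (state_law \<mu>h)"
    using disintegrationD(1)[OF ds] by (rule prob_space.finite_measure)
  fix A B assume A: "A \<in> sets E" and B: "B \<in> sets M"
  then have AB: "A \<times> B \<in> sets (E \<Otimes>\<^sub>M M)" by simp
  \<comment> \<open>Here \<open>\<alpha>\<close> is the coordinate that acts and \<open>\<beta>\<close> the one before it.\<close>
  define K where "K \<alpha> \<beta> = (\<integral>\<^sup>+x. indicator (A \<times> B) (\<alpha>, f \<alpha> x) \<partial>\<nu> \<beta> :: ennreal)" for \<alpha> \<beta>
  have K: "(\<lambda>z. K (fst z) (snd z)) \<in> borel_measurable (E \<Otimes>\<^sub>M E)"
  proof -
    have "(\<lambda>z. (snd z, fst z)) \<in> E \<Otimes>\<^sub>M E \<rightarrow>\<^sub>M E \<Otimes>\<^sub>M E"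
      by (intro measurable_Pair measurable_fst measurable_snd)
    from measurable_compose[OF this measurable_kernel_integral[OF \<nu> AB]] show ?thesis
      by (simp add: K_def)
  qed
  have "emeasure (state_law \<mu>h) (A \<times> B) = (\<integral>\<^sup>+\<alpha>\<in>A. emeasure (distr (q \<alpha> \<bind> \<nu>) M (f \<alpha>)) B \<partial>m)"
    using A B by (intro disintegrationD(6)[OF ds]) (simp_all add: sets_m)
  also have "\<dots> = (\<integral>\<^sup>+\<alpha>. \<integral>\<^sup>+\<beta>. K \<alpha> \<beta> \<partial>q \<alpha> \<partial>m)"
  proof (rule nn_integral_cong)
    fix \<alpha> assume "\<alpha> \<in> space m"
    then have \<alpha>: "\<alpha> \<in> space E" using sets_eq_imp_space_eq[OF sets_m] by simp
    have fB: "(\<lambda>x. indicator B (f \<alpha> x) :: ennreal) \<in> borel_measurable M"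
      by (rule measurable_compose[OF measurable_f_section[OF \<alpha>] borel_measurable_indicator[OF B]])
    have "emeasure (distr (q \<alpha> \<bind> \<nu>) M (f \<alpha>)) B = (\<integral>\<^sup>+\<beta>. \<integral>\<^sup>+x. indicator B (f \<alpha> x) \<partial>\<nu> \<beta> \<partial>q \<alpha>)"
      using emeasure_pushed_kernel[OF \<mu> \<alpha> B] nn_integral_q_average[OF \<nu> fB \<alpha>] by simp
    then show "emeasure (distr (q \<alpha> \<bind> \<nu>) M (f \<alpha>)) B * indicator A \<alpha> = (\<integral>\<^sup>+\<beta>. K \<alpha> \<beta> \<partial>q \<alpha>)"
      by (simp add: K_def indicator_times split: split_indicator)
  qed
  also have "\<dots> = (\<integral>\<^sup>+z. K (fst z) (snd z) \<partial>distr P (E \<Otimes>\<^sub>M E) (\<lambda>\<omega>. (\<omega> 1, \<omega> 0)))"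
  proof -
    have "(\<lambda>z. K (fst z) (snd z)) \<in> borel_measurable (m \<Otimes>\<^sub>M E)"
      using K unfolding measurable_cong_sets[OF sm refl] .
    from nn_integral_disintegration[OF initial_given_next this] show ?thesis by simp
  qed
  also have "\<dots> = (\<integral>\<^sup>+\<omega>. K (\<omega> 1) (\<omega> 0) \<partial>P)"
  proof -
    have "(\<lambda>\<omega>. (\<omega> 1, \<omega> 0)) \<in> P \<rightarrow>\<^sub>M E \<Otimes>\<^sub>M E"
      by (intro measurable_Pair coordinate)
    with K show ?thesis
      by (simp only: nn_integral_distr measurable_distr_eq1 fst_conv snd_conv)
  qed
  also have "\<dots> = (\<integral>\<^sup>+z. emeasure (hat_transition E M p f z) (A \<times> B) \<partial>\<eta>)"
    unfolding K_def by (rule nn_integral_hat_transition[OF d AB, symmetric])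
  also have "\<dots> = emeasure \<eta> (A \<times> B)"
    using S AB by (simp add: S_measures_def stationary_measures_def)
  finally show "emeasure (state_law \<mu>h) (A \<times> B) = emeasure \<eta> (A \<times> B)" .
qed

text \<open>The backward average and its image under the skew product have the same disintegration, because the
state law of the former is \<open>\<eta>\<close>.\<close>
lemma backward_average_invariant:
  assumes S: "\<eta> \<in> S_measures E M p f" and d: "disintegration m M \<eta> \<nu>"
    and d': "disintegration P M \<mu>h (\<lambda>\<omega>. q (\<omega> 0) \<bind> \<nu>)"
  shows "\<mu>h \<in> I0_measures E M P f"
proof -
  have "disintegration m M (state_law \<mu>h) \<nu>"
    using d by (simp only: state_law_of_backward_average[OF S d d'])
  then have "disintegration P M (distr \<mu>h (path_space E \<Otimes>\<^sub>M M) (skew_product f)) (\<lambda>\<omega>. q (\<omega> 0) \<bind> \<nu>)"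
    by (intro disintegration_skew_product[where \<mu> = "\<lambda>\<alpha>. q \<alpha> \<bind> \<nu>", OF d'])
  from disintegration_determines_measure[OF this d'] show ?thesis
    by (subst I0_iff_skew_product_invariant[where \<mu> = "\<lambda>\<alpha>. q \<alpha> \<bind> \<nu>", OF d'])
qed

text \<open>The first component of the chain on \<open>E \<times> M\<close> is itself a chain with kernel \<open>p\<close>.\<close>
lemma S_measures_marginal_stationary:
  assumes \<eta>: "\<eta> \<in> S_measures E M p f"
  shows "distr \<eta> E fst \<in> stationary_measures E p"
proof -
  from \<eta> have prob: "prob_space \<eta>" and s: "sets \<eta> = sets (E \<Otimes>\<^sub>M M)"
    and stat: "\<And>D. D \<in> sets (E \<Otimes>\<^sub>M M) \<Longrightarrow> emeasure \<eta> D = (\<integral>\<^sup>+z. emeasure (hat_transition E M p f z) D \<partial>\<eta>)"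
    by (auto simp: S_measures_def stationary_measures_def space_prob_algebra)
  have fst: "fst \<in> \<eta> \<rightarrow>\<^sub>M E"
    unfolding measurable_cong_sets[OF s refl] by (rule measurable_fst)
  have sp: "space \<eta> = space E \<times> space M"
    using sets_eq_imp_space_eq[OF s] by (simp add: space_pair_measure)
  have "emeasure (distr \<eta> E fst) A = (\<integral>\<^sup>+a. emeasure (p a) A \<partial>distr \<eta> E fst)" if A: "A \<in> sets E" for A
  proof -
    have AM: "A \<times> space M \<in> sets (E \<Otimes>\<^sub>M M)" using A by simp
    have "fst -` A \<inter> space \<eta> = A \<times> space M"
      using sets.sets_into_space[OF A] by (auto simp: sp)
    then have "emeasure (distr \<eta> E fst) A = emeasure \<eta> (A \<times> space M)"
      using fst A by (simp add: emeasure_distr)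
    also have "\<dots> = (\<integral>\<^sup>+z. emeasure (hat_transition E M p f z) (A \<times> space M) \<partial>\<eta>)"
      by (rule stat[OF AM])
    also have "\<dots> = (\<integral>\<^sup>+z. emeasure (p (fst z)) A \<partial>\<eta>)"
    proof (rule nn_integral_cong)
      fix z assume "z \<in> space \<eta>"
      then obtain a x where z: "z = (a, x)" and a: "a \<in> space E" and x: "x \<in> space M"
        by (auto simp: sp)
      have "emeasure (hat_transition E M p f z) (A \<times> space M) = (\<integral>\<^sup>+b. indicator (A \<times> space M) (b, f b x) \<partial>p a)"
        unfolding z by (rule emeasure_hat_transition[OF a x AM])
      also have "\<dots> = (\<integral>\<^sup>+b. indicator A b \<partial>p a)"
        using measurable_space[OF measurable_f_section] sets_eq_imp_space_eq[OF transition_prob_space(1)[OF p a]] x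
        by (intro nn_integral_cong) (auto simp: indicator_times split: split_indicator)
      also have "\<dots> = emeasure (p a) A"
        using A by (simp add: transition_prob_space(1)[OF p a])
      finally show "emeasure (hat_transition E M p f z) (A \<times> space M) = emeasure (p (fst z)) A"
        by (simp add: z)
    qed
    also have "\<dots> = (\<integral>\<^sup>+a. emeasure (p a) A \<partial>distr \<eta> E fst)"
      using fst measurable_emeasure_transition_prob[OF p A]
      by (simp only: nn_integral_distr measurable_distr_eq1)
    finally show ?thesis .
  qed
  moreover have "prob_space (distr \<eta> E fst)"
    by (rule prob_space.prob_space_distr[OF prob fst])
  ultimately show ?thesis by (simp add: stationary_measures_def space_prob_algebra)
qed

lemma bij_betw_state_law:
  assumes M: "standard_borel M" and unique: "stationary_measures E p = {m}"
  shows "bij_betw state_law (I0_measures E M P f) (S_measures E M p f)"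
proof (rule bij_betw_imageI[OF inj_on_state_law], rule antisym)
  show "state_law ` I0_measures E M P f \<subseteq> S_measures E M p f"
    using state_law_stationary by blast
  show "S_measures E M p f \<subseteq> state_law ` I0_measures E M P f"
  proof
    fix \<eta> assume \<eta>: "\<eta> \<in> S_measures E M p f"
    have "distr \<eta> E fst = m"
      using S_measures_marginal_stationary[OF \<eta>] unique by simp
    then have "distr \<eta> m fst = m"
      using distr_cong[OF refl sets_m, of \<eta> fst fst] by simp
    moreover have "prob_space \<eta>" "sets \<eta> = sets (m \<Otimes>\<^sub>M M)"
      using \<eta> sets_pair_measure_cong[OF sets_m refl, of M]
      by (auto simp: S_measures_def stationary_measures_def space_prob_algebra)
    ultimately obtain \<nu> where d: "disintegration m M \<eta> \<nu>"
      using disintegration_exists[OF M, of \<eta> m] by blast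
    have "\<nu> \<in> E \<rightarrow>\<^sub>M prob_algebra M"
      using disintegrationD(5)[OF d] by (simp only: measurable_m_iff)
    then have "(\<lambda>\<omega>. q (\<omega> 0) \<bind> \<nu>) \<in> P \<rightarrow>\<^sub>M prob_algebra M"
      by (rule measurable_compose[OF coordinate measurable_q_average])
    from disintegration_bind[OF prob_P this]
    obtain \<mu>h where d': "disintegration P M \<mu>h (\<lambda>\<omega>. q (\<omega> 0) \<bind> \<nu>)" by blast
    show "\<eta> \<in> state_law ` I0_measures E M P f"
      using backward_average_invariant[OF \<eta> d d'] state_law_of_backward_average[OF \<eta> d d'] by blast
  qed
qed

end

theorem theorem1:
  fixes E :: "'e measure" and M :: "'x measure"
    and p q :: "'e \<Rightarrow> 'e measure" and m :: "'e measure"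
    and P :: "(nat \<Rightarrow> 'e) measure"
    and f :: "'e \<Rightarrow> 'x \<Rightarrow> 'x"
  assumes "standard_borel E" and "standard_borel M"
    and "transition_prob E p"
    and "stationary_measures E p = {m}"
    and "markov_measure E p m P"
    and "(\<lambda>(a, x). f a x) \<in> E \<Otimes>\<^sub>M M \<rightarrow>\<^sub>M M"
    and "in_duality E m p q"
  shows "\<exists>\<Phi> \<Psi>.
     bij_betw \<Phi> (I0_measures E M P f) (S_measures E M p f) \<and>
     bij_betw \<Psi> (S_measures E M p f) (I0_measures E M P f) \<and>
     (\<forall>\<mu>h\<in>I0_measures E M P f. \<Psi> (\<Phi> \<mu>h) = \<mu>h) \<and>
     (\<forall>\<nu>\<in>S_measures E M p f. \<Phi> (\<Psi> \<nu>) = \<nu>) \<and>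
     (\<forall>\<mu>h\<in>I0_measures E M P f. \<forall>\<mu>.
        disintegration P M \<mu>h (\<lambda>\<omega>. \<mu> (\<omega> 0)) \<longrightarrow>
        disintegration m M (\<Phi> \<mu>h) (\<lambda>\<alpha>. distr (\<mu> \<alpha>) M (f \<alpha>))) \<and>
     (\<forall>\<nu>\<in>S_measures E M p f. \<forall>\<nu>'.
        disintegration m M \<nu> \<nu>' \<longrightarrow>
        disintegration P M (\<Psi> \<nu>) (\<lambda>\<omega>. q (\<omega> 0) \<bind> \<nu>'))"
proof -
  interpret random_iteration E p q m P M f
    using assms by unfold_locales
  let ?I = "I0_measures E M P f" and ?S = "S_measures E M p f"
  have bij: "bij_betw state_law ?I ?S"
    by (rule bij_betw_state_law) fact+
  let ?\<Psi> = "inv_into ?I state_law"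
  have \<Psi>: "?\<Psi> \<nu> \<in> ?I" "state_law (?\<Psi> \<nu>) = \<nu>" if "\<nu> \<in> ?S" for \<nu>
    using bij_betwE[OF bij_betw_inv_into[OF bij]] bij_betw_inv_into_right[OF bij] that by auto
  show ?thesis
  proof (intro exI conjI ballI allI impI)
    show "bij_betw state_law ?I ?S" by (rule bij)
    show "bij_betw ?\<Psi> ?S ?I" by (rule bij_betw_inv_into[OF bij])
    show "?\<Psi> (state_law \<mu>h) = \<mu>h" if "\<mu>h \<in> ?I" for \<mu>h
      by (rule bij_betw_inv_into_left[OF bij that])
    show "state_law (?\<Psi> \<nu>) = \<nu>" if "\<nu> \<in> ?S" for \<nu>
      by (rule \<Psi>(2)[OF that])
    show "disintegration m M (state_law \<mu>h) (\<lambda>\<alpha>. distr (\<mu> \<alpha>) M (f \<alpha>))"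
      if "disintegration P M \<mu>h (\<lambda>\<omega>. \<mu> (\<omega> 0))" for \<mu>h \<mu>
      by (rule disintegration_state_law[OF that])
    show "disintegration P M (?\<Psi> \<nu>) (\<lambda>\<omega>. q (\<omega> 0) \<bind> \<nu>')"
      if "\<nu> \<in> ?S" "disintegration m M \<nu> \<nu>'" for \<nu> \<nu>'
      using that by (intro disintegration_of_invariant \<Psi>(1)) (simp_all only: \<Psi>(2))
  qed
qed

end
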